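(* Let $G=(V,E)$ be a finite simple connected graph with a vertex $w$. Then $$\beth^{2}(G/w)\le \beth^{2}(G),$$ where $G/w$ is a graph obtained from $G$ by vertex compression of $w$.
   Context: All graphs are finite and simple. A nonedge contraction of a pair $u,v$ of distinct nonadjacent vertices identifies $u$ and $v$ to a single vertex adjacent to exactly those other vertices that are adjacent to $u$ or $v$ (no loops or multiple edges). Vertex compression: for a vertex $w$ of $G$, let $G_w$ be the induced subgraph of $G$ with vertex set $\Gamma_G(w)\cup\{w\}$, where $\Gamma_G(w)$ is the set of neighbours of $w$. $G/w$ denotes the graph obtained from $G$ by successive nonedge contractions on (pairs of vertices of) $G_w$ so that $G_w$ becomes the complete graph $K_w:=K^{\chi(G_w)}$ on $\chi(G_w)$ vertices in $G/w$; the operation is called the vertex compression of $w$. Equivalently, one takes a proper colouring of $G_w$ with $\chi(G_w)$ colours and identifies, in $G$, the vertices within each colour class. The assertion is for any such choice. $C(G)$ denotes the set of all induced cycles in $G$ (of length at least 3). The second graph characteristic is $\beth^{2}(G)=|C(G)|-|E(G)|+|V(G)|$. *)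

theory Defs
  imports "Graph_Theory.Graph_Theory"
begin

text \<open>
  A finite simple graph is a \<^locale>\<open>pair_graph\<close>: a finite, loop-free digraph whose
  arcs are ordered pairs forming a symmetric relation. Each undirected edge is thus
  represented by two opposite arcs, and \<open>uedges\<close> collects the undirected edges.
\<close>

definition uedges :: "('a, 'b) pre_digraph \<Rightarrow> 'a set set" where
  "uedges G = {{u, v} |u v. u \<rightarrow>\<^bsub>G\<^esub> v}"

definition proper_colouring :: "('a, 'b) pre_digraph \<Rightarrow> nat \<Rightarrow> ('a \<Rightarrow> nat) \<Rightarrow> bool" where
  "proper_colouring G k c \<longleftrightarrow>
     (\<forall>v \<in> verts G. c v < k) \<and> (\<forall>u v. u \<rightarrow>\<^bsub>G\<^esub> v \<longrightarrow> c u \<noteq> c v)"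

definition chromatic_number :: "('a, 'b) pre_digraph \<Rightarrow> nat" where
  "chromatic_number G = (LEAST k. \<exists>c. proper_colouring G k c)"

definition cycle_graph :: "('a, 'b) pre_digraph \<Rightarrow> bool" where
  "cycle_graph C \<longleftrightarrow> graph C \<and>
     (\<exists>vs. distinct vs \<and> length vs \<ge> 3 \<and> verts C = set vs \<and>
       uedges C = {{vs ! i, vs ! (Suc i mod length vs)} |i. i < length vs})"

text \<open>
  An induced subgraph in the sense of \<^const>\<open>induced_subgraph\<close> shares the tail and head
  functions of the ambient graph, so each induced cycle is counted once.
\<close>

definition induced_cycles :: "('a, 'b) pre_digraph \<Rightarrow> ('a, 'b) pre_digraph set" where
  "induced_cycles G = {C. induced_subgraph C G \<and> cycle_graph C}"

definition beth2 :: "('a, 'b) pre_digraph \<Rightarrow> int" where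
  "beth2 G = int (card (induced_cycles G)) - int (card (uedges G)) + int (card (verts G))"

text \<open>
  The vertex obtained by identifying \<open>u\<close> and \<open>v\<close> is named \<open>u\<close>; swapping \<open>u\<close> and \<open>v\<close>
  gives an isomorphic graph. No loop arises when \<open>u\<close> and \<open>v\<close> are nonadjacent.
\<close>

definition nonedge_contract ::
    "'a pair_pre_digraph \<Rightarrow> 'a \<Rightarrow> 'a \<Rightarrow> 'a pair_pre_digraph" where
  "nonedge_contract G u v =
     \<lparr> pverts = pverts G - {v},
       parcs = map_prod (id(v := u)) (id(v := u)) ` parcs G \<rparr>"

text \<open>
  \<open>nonedge_contractions G S H T\<close>: \<open>H\<close> arises from \<open>G\<close> by finitely many successive nonedge
  contractions, each on a pair of vertices of the current image of \<open>S\<close>, and \<open>T\<close> is the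
  image of \<open>S\<close> in \<open>H\<close>.
\<close>

inductive nonedge_contractions ::
    "'a pair_pre_digraph \<Rightarrow> 'a set \<Rightarrow> 'a pair_pre_digraph \<Rightarrow> 'a set \<Rightarrow> bool"
  for G :: "'a pair_pre_digraph" and S :: "'a set" where
  base: "nonedge_contractions G S G S"
| step: "\<lbrakk> nonedge_contractions G S H T; u \<in> T; v \<in> T; u \<noteq> v; (u, v) \<notin> parcs H \<rbrakk>
    \<Longrightarrow> nonedge_contractions G S (nonedge_contract H u v) (T - {v})"

definition closed_nbhd :: "('a, 'b) pre_digraph \<Rightarrow> 'a \<Rightarrow> 'a set" where
  "closed_nbhd G w = insert w {v. w \<rightarrow>\<^bsub>G\<^esub> v}"

text \<open>
  \<open>vertex_compression G w H\<close>: \<open>H\<close> is one of the graphs denoted by \<open>G/w\<close>. It is a relation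
  because the result depends on the choice of the contracted pairs.
\<close>

definition vertex_compression ::
    "'a pair_pre_digraph \<Rightarrow> 'a \<Rightarrow> 'a pair_pre_digraph \<Rightarrow> bool" where
  "vertex_compression G w H \<longleftrightarrow>
     (\<exists>T. nonedge_contractions G (closed_nbhd (with_proj G) w) H T \<and>
       complete_digraph
         (chromatic_number (with_proj G \<restriction> closed_nbhd (with_proj G) w))
         (with_proj H \<restriction> T))"

end

theory Submission
  imports Defs
begin

text \<open>
  Let \<open>N\<close> be the neighbourhood of \<open>w\<close>, \<open>R\<close> the set of vertices outside the closed neighbourhood,
  \<open>f\<close> the identification map, and \<open>k = \<chi>(N)\<close>. Every induced cycle of \<open>G/w\<close> that meets \<open>R\<close> has at
  most two vertices in the clique; replacing them by suitable preimages \<open>a\<close>, \<open>b\<close>, and inserting \<open>w\<close>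
  between \<open>a\<close> and \<open>b\<close> when these are distinct and nonadjacent, lifts it to an induced cycle of \<open>G\<close>
  from which it can be recovered. The remaining induced cycles of \<open>G/w\<close> are the \<open>(k+1 choose 3)\<close>
  triangles of the clique.
  Further induced cycles of \<open>G\<close> are the triangles through \<open>w\<close>, one for each edge in \<open>N\<close>; at least
  \<open>(k choose 3)\<close> cycles inside \<open>N\<close>, found by Kempe chains; and the four-cycles \<open>w, a, r, b\<close> with
  \<open>r \<in> R\<close> and \<open>f a = f b\<close>, which make up for the edges between \<open>R\<close> and \<open>N\<close> lost by identification.
  Counting edges and vertices, these contributions balance exactly.
\<close>

section \<open>Induced paths and cycles\<close>

text \<open>The list enumerates an induced path from one end to the other. Adjacency is tested only
  from a vertex to later ones, which captures all chords once \<open>E\<close> is symmetric.\<close>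

primrec ipath :: "('a \<Rightarrow> 'a \<Rightarrow> bool) \<Rightarrow> 'a list \<Rightarrow> bool" where
  "ipath E [] = True"
| "ipath E (x # xs) = (ipath E xs \<and> x \<notin> set xs \<and> (\<forall>y\<in>set xs. E x y \<longleftrightarrow> y = hd xs))"

text \<open>An induced cycle is represented by its vertex set, so that cycles are counted as sets.
  The witness \<open>x\<close> is a base point closing an induced path through its two ends; two
  path vertices give a triangle.\<close>

definition icycle :: "('a \<Rightarrow> 'a \<Rightarrow> bool) \<Rightarrow> 'a set \<Rightarrow> bool" where
  "icycle E X \<longleftrightarrow> (\<exists>x ps. X = insert x (set ps) \<and> 2 \<le> length ps \<and> ipath E ps \<and> x \<notin> set ps \<and>
     (\<forall>p\<in>set ps. E x p \<longleftrightarrow> p = hd ps \<or> p = last ps))"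

text \<open>The condition localises at the seam, where the single edge between the pieces joins
  \<open>last xs\<close> to \<open>hd ys\<close>. This is what allows paths to be cut and
  reassembled.\<close>

lemma ipath_append:
  "ipath E (xs @ ys) \<longleftrightarrow> ipath E xs \<and> ipath E ys \<and> set xs \<inter> set ys = {} \<and>
     (\<forall>x\<in>set xs. \<forall>y\<in>set ys. E x y \<longleftrightarrow> x = last xs \<and> y = hd ys)"
proof (induction xs)
  case Nil
  then show ?case by simp
next
  case (Cons x xs)
  show ?case
  proof (cases xs)
    case Nil
    then show ?thesis by auto
  next
    case (Cons z zs)
    have l: "last (x # xs) = last xs" "hd (xs @ ys) = hd xs" using Cons by auto
    \<comment> \<open>As \<open>last xs\<close> lies in \<open>xs\<close>, it differs from
      \<open>x\<close>, so the equivalence collapses to nonadjacency; the next fact does the same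
      for \<open>hd xs\<close>.\<close>
    have h1: "(\<forall>y\<in>set ys. E x y \<longleftrightarrow> x = last xs \<and> y = hd ys) \<longleftrightarrow> (\<forall>y\<in>set ys. \<not> E x y)"
      if "x \<notin> set xs" using that Cons last_in_set[of xs] by auto
    have h2: "(\<forall>y\<in>set ys. E x y \<longleftrightarrow> y = hd xs) \<longleftrightarrow> (\<forall>y\<in>set ys. \<not> E x y)"
      if "set xs \<inter> set ys = {}" using that Cons list.set_sel(1)[of xs] by auto
    show ?thesis
    proof (cases "x \<notin> set xs \<and> set xs \<inter> set ys = {}")
      case True
      have "ipath E ((x # xs) @ ys) \<longleftrightarrow> ipath E (xs @ ys) \<and> x \<notin> set ys \<and>
          (\<forall>y\<in>set xs. E x y \<longleftrightarrow> y = hd xs) \<and> (\<forall>y\<in>set ys. \<not> E x y)"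
        using True l(2) h2 by (auto simp: ball_Un)
      also have "\<dots> \<longleftrightarrow> ipath E (x # xs) \<and> ipath E ys \<and> set (x # xs) \<inter> set ys = {} \<and>
          (\<forall>u\<in>set (x # xs). \<forall>y\<in>set ys. E u y \<longleftrightarrow> u = last (x # xs) \<and> y = hd ys)"
        using True h1 unfolding Cons.IH l(1) by (simp add: conj_ac)
      finally show ?thesis .
    next
      case False
      then show ?thesis using Cons.IH by auto
    qed
  qed
qed

lemma ipath_rev:
  assumes "symp E"
  shows "ipath E (rev xs) = ipath E xs"
proof (induction xs)
  case (Cons x xs)
  show ?case
  proof (cases "xs = []")
    case False
    then show ?thesis using Cons assms by (auto simp: ipath_append last_rev symp_def)
  qed simp
qed simp

lemma all_pairs_Cons:
  "(\<forall>i j. i < j \<longrightarrow> j < length (x # xs) \<longrightarrow> P i j) \<longleftrightarrow>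
   (\<forall>j < length xs. P 0 (Suc j)) \<and> (\<forall>i j. i < j \<longrightarrow> j < length xs \<longrightarrow> P (Suc i) (Suc j))"
proof safe
  fix i j assume a: "\<forall>j<length xs. P 0 (Suc j)" "\<forall>i j. i < j \<longrightarrow> j < length xs \<longrightarrow> P (Suc i) (Suc j)"
    "i < j" "j < length (x # xs)"
  then obtain j' where "j = Suc j'" by (cases j) auto
  with a show "P i j" by (cases i) auto
qed auto

lemma ipath_nth:
  "ipath E xs \<longleftrightarrow> distinct xs \<and> (\<forall>i j. i < j \<longrightarrow> j < length xs \<longrightarrow> (E (xs ! i) (xs ! j) \<longleftrightarrow> j = Suc i))"
proof (induction xs)
  case (Cons x xs)
  have hd: "(\<forall>y\<in>set xs. E x y \<longleftrightarrow> y = hd xs) \<longleftrightarrow> (\<forall>j < length xs. E x (xs ! j) \<longleftrightarrow> j = 0)"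
    if "distinct xs"
  proof -
    have "xs ! j = hd xs \<longleftrightarrow> j = 0" if "j < length xs" for j
      using that \<open>distinct xs\<close> by (cases xs) (auto simp: nth_eq_iff_index_eq nth_Cons')
    then show ?thesis by (metis in_set_conv_nth)
  qed
  show ?case unfolding all_pairs_Cons using Cons hd by auto
qed simp

text \<open>No vertex of a cycle is special: if the base point is \<open>x\<close> and the path
  reads \<open>as @ z # bs\<close>, then going round from \<open>z\<close> passes through
  \<open>bs\<close>, then \<open>x\<close>, then \<open>as\<close>. Later arguments may start at any
  convenient vertex.\<close>

lemma icycle_rotate:
  assumes "symp E" "icycle E X" "z \<in> X"
  obtains ps where "X = insert z (set ps)" "2 \<le> length ps" "ipath E ps" "z \<notin> set ps"
    "\<And>p. p \<in> set ps \<Longrightarrow> E z p \<longleftrightarrow> p = hd ps \<or> p = last ps"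
proof -
  obtain x ps where x: "X = insert x (set ps)" "2 \<le> length ps" "ipath E ps" "x \<notin> set ps"
    "\<forall>p\<in>set ps. E x p \<longleftrightarrow> p = hd ps \<or> p = last ps"
    using assms(2) unfolding icycle_def by blast
  show thesis
  proof (cases "z = x")
    case True
    then show thesis using x that by blast
  next
    case False
    then obtain as bs where ps: "ps = as @ z # bs" using x assms(3) by (meson insertE split_list)
    let ?qs = "bs @ x # as"
    have sym: "E u v = E v u" for u v using assms(1) by (auto dest: sympD)
    have ip: "ipath E as" "ipath E bs" "z \<notin> set as" "z \<notin> set bs" "set as \<inter> set bs = {}"
      and zb: "\<And>p. p \<in> set bs \<Longrightarrow> E z p \<longleftrightarrow> p = hd bs"
      and a: "\<And>a y. a \<in> set as \<Longrightarrow> y \<in> set (z # bs) \<Longrightarrow> E a y \<longleftrightarrow> a = last as \<and> y = z"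
      using x(3) unfolding ps by (auto simp: ipath_append)
    have nx: "x \<notin> set as" "x \<notin> set bs" using x(4) ps by auto
    have za: "E z p \<longleftrightarrow> p = last as" if "p \<in> set as" for p
      using a[OF that, of z] sym[of z p] by simp
    have ba: "\<not> E b p" if "p \<in> set as" "b \<in> set bs" for p b
      using a[OF that(1), of b] sym[of b p] that(2) ip(4) by auto
    have xp: "E x p \<longleftrightarrow> p = hd ps \<or> p = last ps" if "p \<in> set ps" for p
      using x(5) that by blast
    have xa: "E x p \<longleftrightarrow> p = hd as" if "p \<in> set as" for p
    proof -
      have "hd ps = hd as" "last ps \<in> set (z # bs)" using that ps by (auto simp: hd_append)
      then show ?thesis using xp[of p] that ip ps by auto
    qed
    have xb: "E x p \<longleftrightarrow> p = last bs" if "p \<in> set bs" for p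
    proof -
      have "last ps = last bs" "hd ps \<in> set (as @ [z])" using that ps by (auto simp: hd_append)
      then show ?thesis using xp[of p] that ip ps by auto
    qed
    \<comment> \<open>The two base points are adjacent exactly when \<open>z\<close> is an end of
      the old path, that is, when one of the two arcs is empty.\<close>
    have zx: "E z x \<longleftrightarrow> as = [] \<or> bs = []"
    proof -
      have "z = hd ps \<longleftrightarrow> as = []" using ip ps by (cases as) auto
      moreover have "z = last ps \<longleftrightarrow> bs = []" using ip ps by (cases bs rule: rev_cases) auto
      ultimately show ?thesis using xp[of z] sym[of z x] ps by simp
    qed
    have "ipath E ?qs"
    proof -
      have "E b y \<longleftrightarrow> b = last bs \<and> y = x" if "b \<in> set bs" "y \<in> set (x # as)" for b y
      proof (cases "y = x")
        case True
        then show ?thesis using xb[OF that(1)] sym[of b x] by simp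
      next
        case False
        then show ?thesis using ba[of y b] that by simp
      qed
      then show ?thesis unfolding ipath_append using ip nx xa by auto
    qed
    moreover have "E z p \<longleftrightarrow> p = hd ?qs \<or> p = last ?qs" if pq: "p \<in> set ?qs" for p
    proof -
      have h: "hd ?qs = (if bs = [] then x else hd bs)" "last ?qs = (if as = [] then x else last as)"
        by (auto simp: hd_append)
      have m: "bs \<noteq> [] \<Longrightarrow> hd bs \<in> set bs" "as \<noteq> [] \<Longrightarrow> last as \<in> set as" by auto
      consider "p \<in> set bs" | "p = x" | "p \<in> set as" using pq by auto
      then show ?thesis
      proof cases
        case 1
        then have "bs \<noteq> []" by auto
        moreover have "p \<noteq> last ?qs"
          using 1 ip(5) nx unfolding h disjoint_iff by (cases "as = []") auto
        ultimately show ?thesis using zb[OF 1] h(1) by simp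
      next
        case 2
        have "x = hd ?qs \<longleftrightarrow> bs = []" unfolding h using m(1) nx by (cases "bs = []") auto
        moreover have "x = last ?qs \<longleftrightarrow> as = []" unfolding h using m(2) nx by (cases "as = []") auto
        ultimately show ?thesis unfolding 2 zx by blast
      next
        case 3
        then have "as \<noteq> []" by auto
        moreover have "p \<noteq> hd ?qs"
          unfolding h using 3 ip(5) nx m(1) by (cases "bs = []") auto
        ultimately show ?thesis using za[OF 3] h(2) by simp
      qed
    qed
    moreover have "X = insert z (set ?qs)" "2 \<le> length ?qs" "z \<notin> set ?qs"
      using x ps by (auto simp: ipath_append)
    ultimately show thesis using that by blast
  qed
qed

lemma ipath_cong:
  assumes "\<And>x y. x \<in> set ps \<Longrightarrow> y \<in> set ps \<Longrightarrow> E x y = E' x y"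
  shows "ipath E ps = ipath E' ps"
  using assms by (induction ps) auto

lemma icycle_cong:
  assumes "icycle E X" "\<And>x y. x \<in> X \<Longrightarrow> y \<in> X \<Longrightarrow> E x y = E' x y"
  shows "icycle E' X"
proof -
  obtain x ps where x: "X = insert x (set ps)" "2 \<le> length ps" "ipath E ps" "x \<notin> set ps"
    "\<forall>p\<in>set ps. E x p \<longleftrightarrow> p = hd ps \<or> p = last ps"
    using assms(1) unfolding icycle_def by blast
  have "ipath E' ps" using ipath_cong[of ps E E'] x(1,3) assms(2) by simp
  moreover have "\<forall>p\<in>set ps. E' x p \<longleftrightarrow> p = hd ps \<or> p = last ps" using x(1,5) assms(2) by simp
  ultimately show ?thesis unfolding icycle_def using x by blast
qed

text \<open>Connects the base-point description with the cyclic edge list in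
  \<open>cycle_graph\<close>: the first list entry serves as base point and the tail as
  path.\<close>

lemma icycle_iff_cyclic_list:
  assumes "symp E" "irreflp E"
  shows "icycle E X \<longleftrightarrow> (\<exists>vs. distinct vs \<and> 3 \<le> length vs \<and> X = set vs \<and>
    {{u, v} |u v. u \<in> X \<and> v \<in> X \<and> E u v} =
    {{vs ! i, vs ! (Suc i mod length vs)} |i. i < length vs})"
proof -
  have sym: "E u v = E v u" for u v using assms(1) by (auto dest: sympD)
  have irr: "\<not> E u u" for u using assms(2) by (auto dest: irreflpD)
  have consec: "{vs ! i, vs ! j} \<in> {{vs ! k, vs ! (Suc k mod length vs)} |k. k < length vs}
      \<longleftrightarrow> j = Suc i \<or> (i = 0 \<and> Suc j = length vs)"
    if "distinct vs" "3 \<le> length vs" "i < j" "j < length vs" for vs :: "'a list" and i j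
  proof -
    have "{vs ! i, vs ! j} \<in> {{vs ! k, vs ! (Suc k mod length vs)} |k. k < length vs} \<longleftrightarrow>
        (\<exists>k < length vs. (i = k \<and> j = Suc k mod length vs) \<or> (j = k \<and> i = Suc k mod length vs))"
    proof -
      have "vs ! p = vs ! q \<longleftrightarrow> p = q" if "p < length vs" "q < length vs" for p q
        using that \<open>distinct vs\<close> by (simp add: nth_eq_iff_index_eq)
      moreover have "Suc k mod length vs < length vs" for k using \<open>3 \<le> length vs\<close> by (intro mod_less_divisor) linarith
      moreover have "i < length vs" using that by simp
      ultimately show ?thesis using \<open>j < length vs\<close>
        unfolding mem_Collect_eq doubleton_eq_iff by (smt (verit))
    qed
    also have "\<dots> \<longleftrightarrow> j = Suc i \<or> (i = 0 \<and> Suc j = length vs)"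
    proof
      assume "\<exists>k < length vs. (i = k \<and> j = Suc k mod length vs) \<or> (j = k \<and> i = Suc k mod length vs)"
      then obtain k where k: "k < length vs"
        "(i = k \<and> j = Suc k mod length vs) \<or> (j = k \<and> i = Suc k mod length vs)" by blast
      have "Suc k mod length vs = (if Suc k = length vs then 0 else Suc k)" using k(1) by simp
      then show "j = Suc i \<or> (i = 0 \<and> Suc j = length vs)"
        using k(2) \<open>i < j\<close> by (auto split: if_splits)
    next
      assume "j = Suc i \<or> (i = 0 \<and> Suc j = length vs)"
      then show "\<exists>k < length vs. (i = k \<and> j = Suc k mod length vs) \<or> (j = k \<and> i = Suc k mod length vs)"
      proof
        assume "j = Suc i"
        then show ?thesis using that by (intro exI[of _ i]) simp
      next
        assume "i = 0 \<and> Suc j = length vs"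
        then show ?thesis using that by (intro exI[of _ j]) simp
      qed
    qed
    finally show ?thesis .
  qed
  \<comment> \<open>Both sides contain only two-element sets of list entries, so their equality may
    be tested on pairs of positions \<open>i < j\<close>.\<close>
  have edges: "{{u, v} |u v. u \<in> set vs \<and> v \<in> set vs \<and> E u v} =
      {{vs ! i, vs ! (Suc i mod length vs)} |i. i < length vs} \<longleftrightarrow>
      (\<forall>i j. i < j \<longrightarrow> j < length vs \<longrightarrow> (E (vs ! i) (vs ! j) \<longleftrightarrow> j = Suc i \<or> (i = 0 \<and> Suc j = length vs)))"
    (is "?A = ?B \<longleftrightarrow> ?C") if vs: "distinct vs" "3 \<le> length vs" for vs :: "'a list"
  proof -
    have A: "{u, v} \<in> ?A \<longleftrightarrow> E u v" if "u \<in> set vs" "v \<in> set vs" for u v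
      using that sym by (auto simp: doubleton_eq_iff)
    have "?A = ?B \<longleftrightarrow> (\<forall>i j. i < j \<longrightarrow> j < length vs \<longrightarrow> ({vs ! i, vs ! j} \<in> ?A \<longleftrightarrow> {vs ! i, vs ! j} \<in> ?B))"
      (is "_ \<longleftrightarrow> ?D")
    proof
      assume D: ?D
      have pair: "\<exists>i j. i < j \<and> j < length vs \<and> e = {vs ! i, vs ! j}" if e: "e \<in> ?A \<union> ?B" for e
      proof -
        obtain p q where pq: "p < length vs" "q < length vs" "p \<noteq> q" "e = {vs ! p, vs ! q}"
        proof -
          consider u v where "u \<in> set vs" "v \<in> set vs" "E u v" "e = {u, v}"
            | i where "i < length vs" "e = {vs ! i, vs ! (Suc i mod length vs)}"
            using e by blast
          then show thesis
          proof cases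
            case 1
            then show thesis using that irr by (metis in_set_conv_nth)
          next
            case 2
            moreover have "0 < length vs" using vs(2) by linarith
            ultimately show thesis
              using that[of i "Suc i mod length vs"] vs(2) by (cases "Suc i = length vs") auto
          qed
        qed
        have "p < q \<or> q < p" using pq(3) by linarith
        then show ?thesis
        proof
          assume "q < p"
          moreover have "e = {vs ! q, vs ! p}" using pq(4) by blast
          ultimately show ?thesis using pq(1) by blast
        qed (use pq in blast)
      qed
      show "?A = ?B"
      proof (rule set_eqI)
        fix e
        show "e \<in> ?A \<longleftrightarrow> e \<in> ?B"
        proof (cases "e \<in> ?A \<union> ?B")
          case True
          then obtain i j where ij: "i < j" "j < length vs" "e = {vs ! i, vs ! j}" using pair by meson
          show ?thesis unfolding ij(3) using D ij(1,2) by (elim allE impE)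
        next
          case False
          then show ?thesis unfolding Un_iff by (simp only: de_Morgan_disj simp_thms)
        qed
      qed
    qed simp
    then show ?thesis using A consec[OF vs] by simp
  qed
  \<comment> \<open>Index 0 gives the condition on the base point \<open>x\<close>; the remaining
    indices say that \<open>ps\<close> is an induced path.\<close>
  have cons: "(\<forall>i j. i < j \<longrightarrow> j < length (x # ps) \<longrightarrow>
      (E ((x # ps) ! i) ((x # ps) ! j) \<longleftrightarrow> j = Suc i \<or> (i = 0 \<and> Suc j = length (x # ps)))) \<longleftrightarrow>
      ipath E ps \<and> (\<forall>p\<in>set ps. E x p \<longleftrightarrow> p = hd ps \<or> p = last ps)" (is "?L \<longleftrightarrow> ?R")
    if "distinct (x # ps)" "2 \<le> length ps" for x ps
  proof -
    have ne: "ps \<noteq> []" using that by auto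
    have h: "(\<forall>p\<in>set ps. E x p \<longleftrightarrow> p = hd ps \<or> p = last ps) \<longleftrightarrow>
        (\<forall>j < length ps. E x (ps ! j) \<longleftrightarrow> j = 0 \<or> Suc j = length ps)"
    proof -
      have "ps ! j = hd ps \<longleftrightarrow> j = 0" "ps ! j = last ps \<longleftrightarrow> Suc j = length ps" if "j < length ps" for j
        using that \<open>distinct (x # ps)\<close> ne by (auto simp: hd_conv_nth last_conv_nth nth_eq_iff_index_eq)
      then show ?thesis unfolding all_set_conv_all_nth by (simp cong: imp_cong)
    qed
    show ?thesis
      unfolding h ipath_nth all_pairs_Cons using that(1) by (simp add: conj_ac)
  qed
  show ?thesis
  proof
    assume "icycle E X"
    then obtain x ps where x: "X = insert x (set ps)" "2 \<le> length ps" "ipath E ps" "x \<notin> set ps"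
      "\<forall>p\<in>set ps. E x p \<longleftrightarrow> p = hd ps \<or> p = last ps"
      unfolding icycle_def by blast
    then have d: "distinct (x # ps)" "3 \<le> length (x # ps)" by (auto simp: ipath_nth)
    have "X = set (x # ps)" using x by simp
    have "{{u, v} |u v. u \<in> X \<and> v \<in> X \<and> E u v} =
        {{(x # ps) ! i, (x # ps) ! (Suc i mod length (x # ps))} |i. i < length (x # ps)}"
      unfolding \<open>X = set (x # ps)\<close> edges[OF d] cons[OF d(1) x(2)] using x(3,5) by (rule conjI)
    then show "\<exists>vs. distinct vs \<and> 3 \<le> length vs \<and> X = set vs \<and>
      {{u, v} |u v. u \<in> X \<and> v \<in> X \<and> E u v} = {{vs ! i, vs ! (Suc i mod length vs)} |i. i < length vs}"
      using d \<open>X = set (x # ps)\<close> by (intro exI[of _ "x # ps"] conjI)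
  next
    assume "\<exists>vs. distinct vs \<and> 3 \<le> length vs \<and> X = set vs \<and>
      {{u, v} |u v. u \<in> X \<and> v \<in> X \<and> E u v} = {{vs ! i, vs ! (Suc i mod length vs)} |i. i < length vs}"
    then obtain vs where vs: "distinct vs" "3 \<le> length vs" "X = set vs"
      "{{u, v} |u v. u \<in> X \<and> v \<in> X \<and> E u v} = {{vs ! i, vs ! (Suc i mod length vs)} |i. i < length vs}"
      by (elim exE conjE)
    obtain x ps where v: "vs = x # ps" using vs by (cases vs) auto
    have d: "distinct (x # ps)" "3 \<le> length (x # ps)" and l: "2 \<le> length ps" using vs v by auto
    have "ipath E ps \<and> (\<forall>p\<in>set ps. E x p \<longleftrightarrow> p = hd ps \<or> p = last ps)"
      using vs(4) unfolding vs(3) v edges[OF d] cons[OF d(1) l] .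
    then show "icycle E X"
      unfolding icycle_def vs(3) v using l d(1) by (intro exI[of _ x] exI[of _ ps]) simp
  qed
qed

text \<open>Seen from \<open>a\<close>, the vertices \<open>b\<close> and \<open>c\<close> must be
  the two ends of the remaining path; as they are adjacent, that path has no further vertex.\<close>

lemma icycle_triangle:
  assumes "symp E" "icycle E X" "a \<in> X" "b \<in> X" "c \<in> X" "a \<noteq> b" "a \<noteq> c" "b \<noteq> c"
    and "E a b" "E a c" "E b c"
  shows "X = {a, b, c}"
proof -
  obtain ps where ps: "X = insert a (set ps)" "2 \<le> length ps" "ipath E ps" "a \<notin> set ps"
    "\<And>p. p \<in> set ps \<Longrightarrow> E a p \<longleftrightarrow> p = hd ps \<or> p = last ps"
    by (rule icycle_rotate[OF assms(1-3)]) (rule that)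
  have bc: "b \<in> set ps" "c \<in> set ps" using assms ps by auto
  then have "{b, c} = {hd ps, last ps}" using ps(5) assms by blast
  then have "E (hd ps) (last ps)" using assms by (auto simp: doubleton_eq_iff dest: sympD)
  obtain x qs where x: "ps = x # qs" "qs \<noteq> []" using ps(2) by (cases ps) (auto simp: Suc_le_eq)
  then have l: "last qs = hd qs" using ps(3) \<open>E (hd ps) (last ps)\<close> by simp
  have "distinct qs" using ps(3) x by (simp add: ipath_nth)
  then have "qs = [last qs]" using l x(2) by (metis distinct.simps(2) last.simps last_in_set list.collapse)
  then have "set ps = {hd ps, last ps}" using x by (metis empty_set last_ConsR list.sel(1) list.simps(15))
  then show ?thesis using ps(1) \<open>{b, c} = {hd ps, last ps}\<close> by simp
qed

lemma icycle_card_ge: "icycle E X \<Longrightarrow> 3 \<le> card X"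
  unfolding icycle_def by (auto simp: ipath_nth distinct_card)

lemma icycle_clique_card:
  assumes "symp E" "icycle E X" "\<And>x y. x \<in> X \<Longrightarrow> y \<in> X \<Longrightarrow> x \<noteq> y \<Longrightarrow> E x y"
  shows "card X = 3"
proof -
  obtain T where "T \<subseteq> X" "card T = 3"
    using icycle_card_ge[OF assms(2)] obtain_subset_with_card_n by metis
  then obtain a b c where abc: "T = {a, b, c}" "a \<noteq> b" "a \<noteq> c" "b \<noteq> c"
    by (auto simp: card_3_iff)
  then have "X = {a, b, c}"
    using icycle_triangle[of E X a b c] assms \<open>T \<subseteq> X\<close> by simp
  then show ?thesis using abc by simp
qed

section \<open>Kempe chains\<close>

text \<open>The suffix starts at the last neighbour of \<open>y\<close> on the path, so
  \<open>y\<close> sees it only at its head.\<close>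

lemma ipath_Cons_suffix:
  assumes "ipath E xs" "y \<notin> set xs" "x \<in> set xs" "E y x"
  obtains as bs where "xs = as @ bs" "bs \<noteq> []" "ipath E (y # bs)"
  using assms
proof (induction xs arbitrary: thesis x)
  case (Cons z zs)
  show ?case
  proof (cases "\<exists>u\<in>set zs. E y u")
    case True
    then obtain u where u: "u \<in> set zs" "E y u" by blast
    show ?thesis
    proof (rule Cons.IH)
      fix as bs assume "zs = as @ bs" "bs \<noteq> []" "ipath E (y # bs)"
      then show ?thesis using Cons.prems(1)[of "z # as" bs] by simp
    qed (use u Cons.prems in auto)
  next
    case False
    then show ?thesis using Cons.prems by (intro Cons.prems(1)[of "[]" "z # zs"]) auto
  qed
qed simp

definition colourable :: "('a \<Rightarrow> 'a \<Rightarrow> bool) \<Rightarrow> 'a set \<Rightarrow> nat \<Rightarrow> bool" where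
  "colourable E X m \<longleftrightarrow> (\<exists>c. (\<forall>v\<in>X. c v < m) \<and> (\<forall>u\<in>X. \<forall>v\<in>X. E u v \<longrightarrow> c u \<noteq> c v))"

lemma colourable_mono: "colourable E X m \<Longrightarrow> m \<le> n \<Longrightarrow> colourable E X n"
  unfolding colourable_def by (meson less_le_trans)

lemma colourable_insert:
  assumes "irreflp E" "colourable E X m"
  shows "colourable E (insert v X) (Suc m)"
proof -
  obtain c where c: "\<forall>x\<in>X. c x < m" "\<forall>u\<in>X. \<forall>x\<in>X. E u x \<longrightarrow> c u \<noteq> c x"
    using assms(2) unfolding colourable_def by blast
  have "\<not> E v v" using assms(1) by (auto dest: irreflpD)
  then show ?thesis
    unfolding colourable_def using c by (intro exI[of _ "c(v := m)"]) (auto simp: less_Suc_eq)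
qed

text \<open>
  If no neighbour of \<open>v\<close> coloured \<open>i\<close> could be joined to one coloured \<open>j\<close> inside the two colour
  classes, a Kempe swap would free the colour \<open>j\<close> for \<open>v\<close>.
\<close>

lemma Kempe_cycle:
  fixes h :: "'a \<Rightarrow> nat"
  assumes sym: "symp E" and irr: "irreflp E"
    and col: "\<forall>x\<in>X. h x < m" "\<forall>x\<in>X. \<forall>y\<in>X. E x y \<longrightarrow> h x \<noteq> h y"
    and notcol: "\<not> colourable E (insert v X) m" and v: "v \<notin> X"
    and ij: "i < m" "j < m" "i \<noteq> j"
  obtains C where "icycle E C" "C \<subseteq> insert v X" "v \<in> C" "h ` (C - {v}) = {i, j}"
proof -
  define Z where "Z = {x \<in> X. h x = i \<or> h x = j}"
  define A where "A = {x \<in> Z. E v x \<and> h x = i}"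
  define B where "B = {x \<in> Z. E v x \<and> h x = j}"
  \<comment> \<open>A good path stays in the two colour classes and reaches \<open>B\<close> for the
    first time at its last vertex. \<open>W\<close>, the set of starting points, is the union of the
    two-coloured components that meet \<open>B\<close>.\<close>
  define good where "good ps \<longleftrightarrow> ps \<noteq> [] \<and> ipath E ps \<and> set ps \<subseteq> Z \<and> last ps \<in> B \<and>
    set (butlast ps) \<inter> B = {}" for ps
  define W where "W = {y. \<exists>ps. good ps \<and> hd ps = y}"
  have sub: "good bs" if "good (as @ bs)" "bs \<noteq> []" for as bs
    using that by (auto simp: good_def ipath_append butlast_append)
  have BW: "B \<subseteq> W"
  proof
    fix b assume "b \<in> B"
    then have "good [b]" by (auto simp: good_def B_def)
    then show "b \<in> W" by (force simp: W_def)
  qed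
  have WZ: "W \<subseteq> Z" unfolding W_def good_def by (auto dest: hd_in_set)
  \<comment> \<open>A neighbour in \<open>B\<close> is a good path by itself, one already on the
    path starts a suffix of it, and any other is put in front after shortcutting to its last
    neighbour on the path.\<close>
  have closed: "y \<in> W" if "x \<in> W" "y \<in> Z" "E y x" for x y
  proof -
    have "\<exists>ps. good ps \<and> hd ps = x" using that(1) by (simp add: W_def)
    then obtain ps where ps: "good ps" "hd ps = x" by blast
    consider "y \<in> B" | "y \<in> set ps" | "y \<notin> B" "y \<notin> set ps" by blast
    then show ?thesis
    proof cases
      case 1
      then show ?thesis using BW by blast
    next
      case 2
      then obtain as bs where "ps = as @ y # bs" by (meson split_list)
      then have "good (y # bs)" using sub ps by blast
      then show ?thesis unfolding W_def by (metis (mono_tags) list.sel(1) mem_Collect_eq)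
    next
      case 3
      have "x \<in> set ps" using ps by (auto simp: good_def)
      then obtain as bs where bs: "ps = as @ bs" "bs \<noteq> []" "ipath E (y # bs)"
        using ipath_Cons_suffix[of E ps y x] 3 \<open>E y x\<close> ps by (auto simp: good_def)
      have "good bs" using sub bs ps by blast
      then have "good (y # bs)" using bs 3 \<open>y \<in> Z\<close> by (auto simp: good_def)
      then show ?thesis unfolding W_def by (metis (mono_tags) list.sel(1) mem_Collect_eq)
    qed
  qed
  have "A \<inter> W \<noteq> {}"
  proof
    assume AW: "A \<inter> W = {}"
    \<comment> \<open>The swap exchanges \<open>i\<close> and \<open>j\<close> on \<open>W\<close>
      only. Neighbours of \<open>v\<close> coloured \<open>j\<close> lie in \<open>B\<close>, hence
      in \<open>W\<close>, and become \<open>i\<close>; those coloured \<open>i\<close> lie in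
      \<open>A\<close>, outside \<open>W\<close>, and stay \<open>i\<close>. So \<open>j\<close> is
      free for \<open>v\<close>.\<close>
    define h' where "h' x = (if x = v then j else if x \<in> W then (if h x = i then j else i) else h x)" for x
    have vX: "h' x \<noteq> j" if "x \<in> X" "E v x" for x
      using that AW BW WZ v ij unfolding h'_def A_def B_def Z_def by auto
    have "h' x \<noteq> h' y" if xy: "x \<in> insert v X" "y \<in> insert v X" "E x y" for x y
    proof -
      have hv: "h' v = j" by (simp add: h'_def)
      have yx: "E y x" using that sym by (auto dest: sympD)
      have neq: "x \<noteq> y" using that irr by (auto dest: irreflpD)
      consider "x = v" "y \<in> X" | "y = v" "x \<in> X" | "x \<in> X" "y \<in> X" using xy neq by blast
      then show ?thesis
      proof cases
        case 1
        then show ?thesis using vX[of y] xy(3) hv by auto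
      next
        case 2
        then show ?thesis using vX[of x] yx hv by auto
      next
        case 3
        then have h: "h x \<noteq> h y" using col(2) xy(3) by blast
        have xv: "x \<noteq> v" "y \<noteq> v" using 3 v by auto
        have iff: "x \<in> W \<longleftrightarrow> y \<in> W" if "x \<in> Z" "y \<in> Z"
          using closed[of x y] closed[of y x] that yx xy(3) by blast
        have Z: "u \<in> Z \<longleftrightarrow> h u = i \<or> h u = j" if "u \<in> X" for u using that by (simp add: Z_def)
        show ?thesis
          unfolding h'_def using h xv iff Z[OF 3(1)] Z[OF 3(2)] WZ by (smt (verit) subsetD)
      qed
    qed
    moreover have "\<forall>x\<in>insert v X. h' x < m" using col(1) ij by (auto simp: h'_def)
    ultimately have "colourable E (insert v X) m" unfolding colourable_def by blast
    then show False using notcol by blast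
  qed
  then obtain ps where ps: "good ps" "hd ps \<in> A" unfolding W_def by blast
  then have "\<exists>x\<in>set ps. x \<in> A" unfolding good_def by (meson hd_in_set)
  \<comment> \<open>Starting at the last vertex of the path in \<open>A\<close> leaves
    \<open>v\<close> with exactly two neighbours on the suffix: its first vertex in \<open>A\<close>
    and its last in \<open>B\<close>.\<close>
  then obtain as a bs where a: "ps = as @ a # bs" "a \<in> A" "\<forall>z\<in>set bs. z \<notin> A"
    using split_list_last_prop[of ps "\<lambda>x. x \<in> A"] by blast
  let ?qs = "a # bs"
  have g: "good ?qs" using sub a ps by blast
  have AB: "A \<inter> B = {}" using ij by (auto simp: A_def B_def)
  have "bs \<noteq> []" using g a(2) AB by (auto simp: good_def)
  moreover have "E v p \<longleftrightarrow> p = hd ?qs \<or> p = last ?qs" if "p \<in> set ?qs" for p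
  proof
    assume "E v p"
    then have "p \<in> A \<or> p \<in> B" using g that by (auto simp: good_def A_def B_def Z_def)
    then show "p = hd ?qs \<or> p = last ?qs"
    proof
      assume "p \<in> B"
      then have "p \<notin> set (butlast ?qs)" using g by (auto simp: good_def)
      moreover have "set ?qs = insert (last ?qs) (set (butlast ?qs))"
        by (metis append_butlast_last_id list.discI list.simps(15) rotate1.simps(2) set_rotate1)
      ultimately show ?thesis using that by blast
    qed (use a that in auto)
  next
    assume "p = hd ?qs \<or> p = last ?qs"
    moreover have "last ?qs \<in> B" using g by (simp add: good_def)
    ultimately show "E v p" using a(2) by (auto simp: A_def B_def)
  qed
  moreover have vq: "v \<notin> set ?qs" "set ?qs \<subseteq> X" using g v by (auto simp: good_def Z_def)
  ultimately have "icycle E (insert v (set ?qs))"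
    unfolding icycle_def using g
    by (intro exI[of _ v] exI[of _ ?qs]) (auto simp: good_def Suc_le_eq)
  moreover have "h ` (insert v (set ?qs) - {v}) = {i, j}"
  proof -
    have "h a = i" using a(2) by (simp add: A_def)
    moreover have "last ?qs \<in> set ?qs" "h (last ?qs) = j" using g by (auto simp: good_def B_def)
    moreover have "h ` set ?qs \<subseteq> {i, j}" using g by (auto simp: good_def Z_def)
    moreover have "a \<in> set ?qs" by simp
    moreover have "insert v (set ?qs) - {v} = set ?qs" using vq by blast
    ultimately show ?thesis by (smt (verit) image_eqI insert_subset empty_subsetI subset_antisym)
  qed
  ultimately show thesis using that[of "insert v (set ?qs)"] vq by auto
qed

text \<open>The hypothesis says that the chromatic number of \<open>X\<close> is at least
  \<open>k\<close>. Vertices are discarded while this persists. At a critical set, removing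
  \<open>v\<close> leaves chromatic number \<open>k - 1\<close>: by induction the rest supplies
  \<open>(k - 1) choose 3\<close> cycles, and each pair of the \<open>k - 1\<close> colours gives a
  Kempe cycle through \<open>v\<close>. Pascal's rule adds these up.\<close>

lemma card_icycles_ge:
  assumes sym: "symp E" and irr: "irreflp E"
    and "finite X" "\<And>m. m < k \<Longrightarrow> \<not> colourable E X m"
  shows "k choose 3 \<le> card {C. icycle E C \<and> C \<subseteq> X}"
  using assms(3,4)
proof (induction X arbitrary: k rule: finite_psubset_induct)
  case (psubset X)
  have fin: "finite {C. icycle E C \<and> C \<subseteq> Y}" if "Y \<subseteq> X" for Y
    by (rule finite_subset[of _ "Pow X"]) (use that psubset.hyps in auto)
  show ?case
  proof (cases k)
    case (Suc m)
    have "X \<noteq> {}" using psubset.prems[of 0] Suc by (auto simp: colourable_def)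
    show ?thesis
    proof (cases "\<exists>v\<in>X. \<forall>m'<k. \<not> colourable E (X - {v}) m'")
      case True
      then obtain v where v: "v \<in> X" "\<forall>m'<k. \<not> colourable E (X - {v}) m'" by blast
      then have "k choose 3 \<le> card {C. icycle E C \<and> C \<subseteq> X - {v}}"
        by (intro psubset.IH) auto
      also have "\<dots> \<le> card {C. icycle E C \<and> C \<subseteq> X}"
        by (intro card_mono fin) auto
      finally show ?thesis .
    next
      case False
      obtain v where v: "v \<in> X" using \<open>X \<noteq> {}\<close> by blast
      let ?Y = "X - {v}"
      have X: "insert v ?Y = X" using v by blast
      have "colourable E ?Y m" using False v Suc colourable_mono by (metis less_Suc_eq_le)
      then obtain h where h: "\<forall>x\<in>?Y. h x < m" "\<forall>x\<in>?Y. \<forall>y\<in>?Y. E x y \<longrightarrow> h x \<noteq> h y"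
        unfolding colourable_def by blast
      \<comment> \<open>Deleting a vertex lowers the chromatic number by at most one, since it can
        be restored with a fresh colour.\<close>
      have "\<not> colourable E ?Y m'" if "m' < m" for m'
        using psubset.prems[of "Suc m'"] that Suc colourable_insert[OF irr, of ?Y m' v] X by auto
      then have le3: "m choose 3 \<le> card {C. icycle E C \<and> C \<subseteq> ?Y}"
        using v by (intro psubset.IH) auto
      define P where "P = {p. p \<subseteq> {..<m} \<and> card p = 2}"
      have "\<exists>C. icycle E C \<and> C \<subseteq> X \<and> v \<in> C \<and> h ` (C - {v}) = p" if "p \<in> P" for p
      proof -
        obtain i j where p: "p = {i, j}" "i \<noteq> j" using \<open>p \<in> P\<close> unfolding P_def by (auto simp: card_2_iff)
        then have "i < m" "j < m" using \<open>p \<in> P\<close> by (auto simp: P_def)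
        moreover have "\<not> colourable E (insert v ?Y) m" using psubset.prems[of m] Suc X by simp
        ultimately show ?thesis
          using Kempe_cycle[OF sym irr h, of v i j] p X by (metis Diff_iff insertI1)
      qed
      then obtain F where F: "\<And>p. p \<in> P \<Longrightarrow> icycle E (F p) \<and> F p \<subseteq> X \<and> v \<in> F p \<and> h ` (F p - {v}) = p"
        by metis
      have "m choose 2 = card P" unfolding P_def using n_subsets[of "{..<m}" 2] by simp
      \<comment> \<open>Distinct pairs give distinct cycles, because the colours on
        \<open>F p\<close> without \<open>v\<close> return \<open>p\<close>.\<close>
      also have "\<dots> = card (F ` P)"
        using F by (intro card_image[symmetric]) (metis inj_onI)
      also have "\<dots> \<le> card {C. icycle E C \<and> C \<subseteq> X \<and> v \<in> C}"
        using F by (intro card_mono finite_subset[OF _ fin[of X]]) auto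
      finally have le2: "m choose 2 \<le> card {C. icycle E C \<and> C \<subseteq> X \<and> v \<in> C}" .
      have "k choose 3 = (m choose 2) + (m choose 3)" by (simp add: Suc numeral_3_eq_3 numeral_2_eq_2)
      also have "\<dots> \<le> card {C. icycle E C \<and> C \<subseteq> X \<and> v \<in> C} + card {C. icycle E C \<and> C \<subseteq> ?Y}"
        using le2 le3 by simp
      also have "\<dots> = card ({C. icycle E C \<and> C \<subseteq> X \<and> v \<in> C} \<union> {C. icycle E C \<and> C \<subseteq> ?Y})"
        by (intro card_Un_disjoint[symmetric] finite_subset[OF _ fin[of X]]) auto
      also have "\<dots> \<le> card {C. icycle E C \<and> C \<subseteq> X}"
        by (intro card_mono fin) auto
      finally show ?thesis .
    qed
  qed (simp add: binomial_eq_0)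
qed

section \<open>Compression of a vertex\<close>

text \<open>No neighbour of \<open>w\<close> lies in \<open>R\<close>, so an edge is inside
  \<open>R\<close>, inside \<open>N\<close>, at \<open>w\<close>, or between \<open>R\<close> and
  \<open>N\<close>. The last kind is counted by ordered pairs so that the identification map can act
  on the endpoint in \<open>N\<close>. The lemma serves both the graph and its compression.\<close>

lemma card_edges_at_vertex:
  fixes E :: "'a \<Rightarrow> 'a \<Rightarrow> bool" and w :: 'a
  assumes sym: "symp E" and irr: "irreflp E" and fin: "finite V" and EV: "\<And>a b. E a b \<Longrightarrow> a \<in> V"
  defines "N \<equiv> {v. E w v}"
  defines "R \<equiv> V - insert w N"
  shows "card {{u, v} |u v. E u v} =
    card {{u, v} |u v. u \<in> R \<and> v \<in> R \<and> E u v} + card {{u, v} |u v. u \<in> N \<and> v \<in> N \<and> E u v} +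
    card N + card {(r, a). r \<in> R \<and> a \<in> N \<and> E r a}"
proof -
  let ?A = "{{u, v} |u v. u \<in> R \<and> v \<in> R \<and> E u v}"
  let ?B = "{{u, v} |u v. u \<in> N \<and> v \<in> N \<and> E u v}"
  let ?C = "(\<lambda>v. {w, v}) ` N"
  let ?D = "(\<lambda>(r, a). {r, a}) ` {(r, a). r \<in> R \<and> a \<in> N \<and> E r a}"
  have s: "E u v \<Longrightarrow> E v u" for u v using sym by (auto dest: sympD)
  have i: "\<not> E u u" for u using irr by (auto dest: irreflpD)
  have w: "w \<notin> N" "w \<notin> R" "N \<inter> R = {}" using i by (auto simp: N_def R_def)
  have "N \<subseteq> V" using EV s by (auto simp: N_def)
  then have fN: "finite N" "finite R" using fin by (auto simp: R_def intro: finite_subset)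
  have fA: "finite ?A" by (rule finite_subset[of _ "Pow R"]) (use fN in auto)
  have fB: "finite ?B" by (rule finite_subset[of _ "Pow N"]) (use fN in auto)
  have fD: "finite {(r, a). r \<in> R \<and> a \<in> N \<and> E r a}"
    by (rule finite_subset[of _ "R \<times> N"]) (use fN in auto)
  have cls: "u = w \<or> u \<in> N \<or> u \<in> R" if "E u v" for u v using EV[OF that] by (auto simp: R_def)
  have wN: "E u w \<Longrightarrow> u \<in> N" "E w u \<Longrightarrow> u \<in> N" for u using s by (auto simp: N_def)
  have "{{u, v} |u v. E u v} = ?A \<union> ?B \<union> ?C \<union> ?D" (is "?L = ?R")
  proof (intro equalityI subsetI)
    fix e assume "e \<in> ?L"
    then obtain u v where uv: "e = {u, v}" "E u v" by blast
    have vu: "E v u" using s uv by blast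
    have e': "e = {v, u}" using uv by blast
    consider "u = w" | "v = w" | "u \<in> R" "v \<in> R" | "u \<in> N" "v \<in> N" | "u \<in> R" "v \<in> N" | "u \<in> N" "v \<in> R"
      using cls[OF uv(2)] cls[OF vu] by blast
    then show "e \<in> ?R"
    proof cases
      case 1
      then have "e \<in> ?C" using uv wN by blast
      then show ?thesis by blast
    next
      case 2
      then have "e \<in> ?C" using uv e' wN by blast
      then show ?thesis by blast
    next
      case 5
      then have "e \<in> ?D" using uv by (intro image_eqI[of _ _ "(u, v)"]) auto
      then show ?thesis by blast
    next
      case 6
      then have "e \<in> ?D" using e' vu by (intro image_eqI[of _ _ "(v, u)"]) auto
      then show ?thesis by blast
    qed (use uv in blast)+
  next
    fix e assume "e \<in> ?R"
    then show "e \<in> ?L" by (auto simp: N_def)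
  qed
  moreover have "card (?A \<union> ?B \<union> ?C \<union> ?D) = card ?A + card ?B + card ?C + card ?D"
  proof -
    have "?A \<inter> ?B = {}" using w by (auto simp: doubleton_eq_iff)
    moreover have "(?A \<union> ?B) \<inter> ?C = {}" using w by (auto simp: doubleton_eq_iff)
    moreover have "(?A \<union> ?B \<union> ?C) \<inter> ?D = {}" using w by (auto simp: doubleton_eq_iff)
    ultimately show ?thesis using fA fB fN fD by (simp add: card_Un_disjoint)
  qed
  moreover have "card ?C = card N"
    by (intro card_image inj_onI) (use w in \<open>auto simp: doubleton_eq_iff\<close>)
  moreover have "card ?D = card {(r, a). r \<in> R \<and> a \<in> N \<and> E r a}"
    by (intro card_image inj_onI) (use w in \<open>auto simp: doubleton_eq_iff\<close>)
  ultimately show ?thesis by simp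
qed

text \<open>
  The map \<open>f\<close> identifies the colour classes, so that \<open>T\<close> is the set of neighbours of \<open>w\<close> and \<open>F\<close>
  the adjacency relation in the compressed graph on \<open>f ` V\<close>.
\<close>

locale compression =
  fixes E :: "'a \<Rightarrow> 'a \<Rightarrow> bool" and V :: "'a set" and w :: 'a and f :: "'a \<Rightarrow> 'a"
    and N R T :: "'a set" and F :: "'a \<Rightarrow> 'a \<Rightarrow> bool"
  defines "N \<equiv> {v. E w v}"
    and "R \<equiv> V - insert w N"
    and "T \<equiv> f ` N"
    and "F \<equiv> \<lambda>s t. \<exists>a b. E a b \<and> f a = s \<and> f b = t"
  assumes fin: "finite V" and wV: "w \<in> V" and symE: "symp E" and irrE: "irreflp E"
    and EV: "E a b \<Longrightarrow> a \<in> V"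
    and fR: "x \<in> R \<Longrightarrow> f x = x" and fw: "f w = w" and fN: "x \<in> N \<Longrightarrow> f x \<in> N"
    and proper: "E a b \<Longrightarrow> f a \<noteq> f b"
    and complete: "s \<in> T \<Longrightarrow> t \<in> T \<Longrightarrow> s \<noteq> t \<Longrightarrow> F s t"
    and chromatic: "m < card T \<Longrightarrow> \<not> colourable E N m"
begin

section \<open>Adjacency in the compressed graph\<close>

lemma E_sym: "E u v \<longleftrightarrow> E v u"
  using symE by (auto dest: sympD)

lemma E_irr: "\<not> E u u"
  using irrE by (auto dest: irreflpD)

lemma symF: "symp F"
  unfolding F_def using E_sym by (auto intro!: sympI)

lemma irrF: "irreflp F"
  unfolding F_def by (rule irreflpI) (metis proper)

lemma F_sym: "F u v \<longleftrightarrow> F v u"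
  using symF by (auto dest: sympD)

lemma vertex_partition:
  "w \<notin> N" "w \<notin> R" "N \<inter> R = {}" "T \<subseteq> N" "w \<notin> T" "T \<inter> R = {}" "V = insert w (N \<union> R)"
  "finite N" "finite R" "finite T" "N \<subseteq> V"
proof -
  show "w \<notin> N" using E_irr by (simp add: N_def)
  show "w \<notin> R" "N \<inter> R = {}" by (auto simp: R_def)
  show "T \<subseteq> N" using fN by (auto simp: T_def)
  then show "w \<notin> T" "T \<inter> R = {}" using \<open>w \<notin> N\<close> by (auto simp: R_def)
  show "N \<subseteq> V" using EV E_sym by (auto simp: N_def)
  then show "V = insert w (N \<union> R)" using wV by (auto simp: R_def)
  show "finite N" using \<open>N \<subseteq> V\<close> fin by (rule finite_subset)
  then show "finite R" "finite T" using fin by (auto simp: R_def T_def)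
qed

lemma E_V: "E a b \<Longrightarrow> a \<in> insert w (N \<union> R) \<and> b \<in> insert w (N \<union> R)"
  using EV E_sym vertex_partition(7) by blast

lemma fV: "f ` V = insert w (T \<union> R)"
proof -
  have "f ` R = R" using fR by auto
  then show ?thesis unfolding vertex_partition(7) using fw by (simp add: image_Un T_def)
qed

lemma f_eq_w: "a \<in> V \<Longrightarrow> f a = w \<longleftrightarrow> a = w"
  using vertex_partition fR fw fN by (metis Un_iff insertE)

lemma f_in_R: "a \<in> V \<Longrightarrow> f a \<in> R \<Longrightarrow> f a = a \<and> a \<in> R"
  using vertex_partition fR fw fN by (metis Un_iff disjoint_iff insertE)

lemma f_in_T: "a \<in> V \<Longrightarrow> f a \<in> T \<Longrightarrow> a \<in> N"
  using vertex_partition fR fw fN by (metis Un_iff disjoint_iff insertE)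

lemma F_w: "F w t \<longleftrightarrow> t \<in> T"
proof
  assume "F w t"
  then obtain a b where "E a b" "f a = w" "f b = t" by (auto simp: F_def)
  then show "t \<in> T" using f_eq_w[of a] EV[of a b] by (auto simp: T_def N_def)
next
  assume "t \<in> T"
  then show "F w t" using fw by (auto simp: T_def N_def F_def)
qed

lemma F_R: "r \<in> R \<Longrightarrow> s \<in> R \<Longrightarrow> F r s \<longleftrightarrow> E r s"
  unfolding F_def using f_in_R fR E_V vertex_partition(7) by metis

lemma F_T_R: "t \<in> T \<Longrightarrow> r \<in> R \<Longrightarrow> F t r \<longleftrightarrow> (\<exists>a\<in>N. f a = t \<and> E a r)"
  unfolding F_def using f_in_R fR f_in_T E_V vertex_partition(7) by metis

lemma F_V: "F a b \<Longrightarrow> a \<in> f ` V"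
  unfolding F_def using EV by auto

lemma ipath_F_R: "set qs \<subseteq> R \<Longrightarrow> ipath F qs = ipath E qs"
  by (rule ipath_cong) (use F_R in auto)

section \<open>Lifting induced cycles from the compressed graph\<close>

text \<open>With base point \<open>w\<close>, the path is \<open>b # qs @ [a]\<close>: its ends are
  neighbours of \<open>w\<close>, while its interior lies in \<open>R\<close> and has none.\<close>

lemma icycle_through_w:
  assumes "a \<in> N" "b \<in> N" "a \<noteq> b" "\<not> E a b" "qs \<noteq> []" "set qs \<subseteq> R" "ipath E qs"
    and "\<And>p. p \<in> set qs \<Longrightarrow> E b p \<longleftrightarrow> p = hd qs" "\<And>p. p \<in> set qs \<Longrightarrow> E a p \<longleftrightarrow> p = last qs"
  shows "icycle E (insert w (insert a (insert b (set qs))))"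
proof -
  have nq: "a \<notin> set qs" "b \<notin> set qs" "w \<notin> set qs" "a \<noteq> w" "b \<noteq> w" "\<not> E b a"
    using assms vertex_partition E_sym by auto
  have "ipath E (qs @ [a])" using assms nq E_sym[of _ a] by (auto simp: ipath_append)
  then have ip: "ipath E (b # qs @ [a])" using assms nq by auto
  have "E w p \<longleftrightarrow> p \<in> N" for p by (simp add: N_def)
  then have "\<forall>p\<in>set (b # qs @ [a]). E w p \<longleftrightarrow> p = hd (b # qs @ [a]) \<or> p = last (b # qs @ [a])"
    using assms vertex_partition(3) nq by auto
  then show ?thesis
    unfolding icycle_def using ip nq by (intro exI[of _ w] exI[of _ "b # qs @ [a]"]) auto
qed

text \<open>The two cycle edges at \<open>t\<close> may come from different preimages of
  \<open>t\<close>. If one preimage sees both ends of \<open>qs\<close>, it replaces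
  \<open>t\<close>; otherwise two preimages of the same colour, hence nonadjacent, are joined
  through \<open>w\<close>. The conclusions on \<open>R\<close> and \<open>N\<close> make the
  original cycle recoverable.\<close>

lemma lift_cycle_one:
  assumes "t \<in> T" "set qs \<subseteq> R" "2 \<le> length qs" "ipath F qs"
    and adj: "\<And>p. p \<in> set qs \<Longrightarrow> F t p \<longleftrightarrow> p = hd qs \<or> p = last qs"
  obtains X where "icycle E X" "X \<subseteq> V" "X \<inter> R = set qs" "f ` (X \<inter> N) = {t}"
proof -
  note result = that
  have ip: "ipath E qs" using ipath_F_R assms by blast
  have ne: "qs \<noteq> []" using assms by auto
  then have hl: "hd qs \<in> set qs" "last qs \<in> set qs" by auto
  obtain a where a: "a \<in> N" "f a = t" "E a (last qs)"
    using F_T_R[of t "last qs"] adj hl assms by blast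
  obtain b where b: "b \<in> N" "f b = t" "E b (hd qs)"
    using F_T_R[of t "hd qs"] adj hl assms by blast
  have only: "p = hd qs \<or> p = last qs" if "x \<in> N" "f x = t" "E x p" "p \<in> set qs" for x p
    using F_T_R[of t p] adj that assms by blast
  have nN: "x \<notin> set qs" if "x \<in> N" for x using that vertex_partition assms by blast
  have trace: "X \<inter> R = set qs \<and> f ` (X \<inter> N) = {t} \<and> X \<subseteq> V"
    if "X = U \<union> W \<union> set qs" "U \<subseteq> N" "U \<noteq> {}" "\<forall>u\<in>U. f u = t" "W \<subseteq> {w}" for X U W
  proof -
    have "X \<inter> R = set qs" using that vertex_partition assms(2) by blast
    moreover have "X \<inter> N = U" using that vertex_partition assms(2) by blast
    moreover have "f ` U = {t}" using that by auto
    moreover have "X \<subseteq> V" using that vertex_partition assms(2) by blast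
    ultimately show ?thesis by simp
  qed
  have single: thesis if "x \<in> N" "f x = t" "E x (hd qs)" "E x (last qs)" for x
  proof -
    have "\<forall>p\<in>set qs. E x p \<longleftrightarrow> p = hd qs \<or> p = last qs"
      using only[OF that(1,2)] that(3,4) by auto
    then have c: "icycle E (insert x (set qs))"
      unfolding icycle_def
      by (intro exI[of _ x] exI[of _ qs]) (use assms(3) ip nN[OF that(1)] in auto)
    have "insert x (set qs) = {x} \<union> {} \<union> set qs" by simp
    then have "insert x (set qs) \<inter> R = set qs \<and> f ` (insert x (set qs) \<inter> N) = {t} \<and>
        insert x (set qs) \<subseteq> V"
      by (rule trace) (use that in auto)
    then show thesis using c by (intro result) blast+
  qed
  show thesis
  proof (cases "E a (hd qs) \<or> E b (last qs)")
    case True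
    then show thesis using single a b by blast
  next
    case False
    \<comment> \<open>Nonadjacency comes from \<open>f a = f b\<close>, as \<open>f\<close>
      separates adjacent vertices.\<close>
    have "a \<noteq> b" "\<not> E a b" using a b False proper[of a b] by auto
    moreover have "E b p \<longleftrightarrow> p = hd qs" "E a p \<longleftrightarrow> p = last qs" if "p \<in> set qs" for p
      using only that a b False by blast+
    ultimately have c: "icycle E (insert w (insert a (insert b (set qs))))"
      using a b ne assms ip by (intro icycle_through_w) auto
    have "insert w (insert a (insert b (set qs))) = {a, b} \<union> {w} \<union> set qs" by auto
    then have "insert w (insert a (insert b (set qs))) \<inter> R = set qs \<and>
        f ` (insert w (insert a (insert b (set qs))) \<inter> N) = {t} \<and>
        insert w (insert a (insert b (set qs))) \<subseteq> V"
      by (rule trace) (use a b in auto)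
    then show thesis using c by (intro that) blast+
  qed
qed

text \<open>Preimages \<open>a\<close> and \<open>b\<close> are chosen for the edges into
  \<open>qs\<close> only. The clique edge between \<open>t\<close> and \<open>s\<close> need not
  lift to an edge between these two, and then \<open>w\<close> is inserted.\<close>

lemma lift_cycle_two:
  assumes "t \<in> T" "s \<in> T" "t \<noteq> s" "set qs \<subseteq> R" "qs \<noteq> []" "ipath F qs"
    and adj_s: "\<And>p. p \<in> set qs \<Longrightarrow> F s p \<longleftrightarrow> p = hd qs"
    and adj_t: "\<And>p. p \<in> set qs \<Longrightarrow> F t p \<longleftrightarrow> p = last qs"
  obtains X where "icycle E X" "X \<subseteq> V" "X \<inter> R = set qs" "f ` (X \<inter> N) = {t, s}"
proof -
  have ip: "ipath E qs" using ipath_F_R assms by blast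
  have hl: "hd qs \<in> set qs" "last qs \<in> set qs" using assms by auto
  obtain a where a: "a \<in> N" "f a = t" "E a (last qs)"
    using F_T_R[of t "last qs"] adj_t hl assms by blast
  obtain b where b: "b \<in> N" "f b = s" "E b (hd qs)"
    using F_T_R[of s "hd qs"] adj_s hl assms by blast
  have ab: "a \<noteq> b" using a b assms by blast
  have only_b: "E b p \<longleftrightarrow> p = hd qs" if "p \<in> set qs" for p
    using F_T_R[of s p] adj_s that assms b by blast
  have only_a: "E a p \<longleftrightarrow> p = last qs" if "p \<in> set qs" for p
    using F_T_R[of t p] adj_t that assms a by blast
  have nN: "x \<notin> set qs" if "x \<in> N" for x using that vertex_partition assms by blast
  have trace: "X \<inter> R = set qs \<and> f ` (X \<inter> N) = {t, s} \<and> X \<subseteq> V"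
    if "X = {a, b} \<union> W \<union> set qs" "W \<subseteq> {w}" for X W
  proof -
    have "X \<inter> R = set qs" using that vertex_partition assms a b by blast
    moreover have "X \<inter> N = {a, b}" using that vertex_partition assms a b by blast
    moreover have "X \<subseteq> V" using that vertex_partition assms a b by blast
    ultimately show ?thesis using a b by simp
  qed
  show thesis
  proof (cases "E a b")
    case True
    have "ipath E (b # qs)" using ip nN[OF b(1)] only_b by simp
    moreover have "E a p \<longleftrightarrow> p = hd (b # qs) \<or> p = last (b # qs)" if "p \<in> set (b # qs)" for p
      using that only_a True assms(5) nN[OF b(1)] by auto
    ultimately have c: "icycle E (insert a (set (b # qs)))"
      unfolding icycle_def using assms(5) ab nN[OF a(1)]
      by (intro exI[of _ a] exI[of _ "b # qs"]) (auto simp: Suc_le_eq)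
    have "insert a (set (b # qs)) = {a, b} \<union> {} \<union> set qs" by auto
    then have "insert a (set (b # qs)) \<inter> R = set qs \<and>
        f ` (insert a (set (b # qs)) \<inter> N) = {t, s} \<and> insert a (set (b # qs)) \<subseteq> V"
      by (rule trace) simp
    then show thesis using c by (intro that) blast+
  next
    case False
    then have c: "icycle E (insert w (insert a (insert b (set qs))))"
      using a b assms ip only_a only_b ab by (intro icycle_through_w) auto
    have "insert w (insert a (insert b (set qs))) = {a, b} \<union> {w} \<union> set qs" by auto
    then have "insert w (insert a (insert b (set qs))) \<inter> R = set qs \<and>
        f ` (insert w (insert a (insert b (set qs))) \<inter> N) = {t, s} \<and>
        insert w (insert a (insert b (set qs))) \<subseteq> V"
      by (rule trace) simp
    then show thesis using c by (intro that) blast+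
  qed
qed

text \<open>The two neighbours of \<open>w\<close> on the cycle lie in the clique \<open>T\<close>,
  so a cycle through \<open>w\<close> is a triangle that misses \<open>R\<close>.\<close>

lemma icycle_F_no_w:
  assumes "icycle F Y" "Y \<inter> R \<noteq> {}"
  shows "w \<notin> Y"
proof
  assume "w \<in> Y"
  obtain ps where ps: "Y = insert w (set ps)" "2 \<le> length ps" "ipath F ps" "w \<notin> set ps"
    "\<And>p. p \<in> set ps \<Longrightarrow> F w p \<longleftrightarrow> p = hd ps \<or> p = last ps"
    by (rule icycle_rotate[OF symF assms(1) \<open>w \<in> Y\<close>]) (rule that)
  have "ps \<noteq> []" using ps by auto
  then have hl: "hd ps \<in> set ps" "last ps \<in> set ps" by auto
  have T: "hd ps \<in> T" "last ps \<in> T" using ps(5) hl F_w by blast+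
  have "hd ps \<noteq> last ps"
  proof -
    obtain x qs where "ps = x # qs" "qs \<noteq> []" using ps(2) by (cases ps) (auto simp: Suc_le_eq)
    then show ?thesis using ps(3) by (auto simp: ipath_nth)
  qed
  then have "Y = {w, hd ps, last ps}"
    using T hl ps(1,4) F_w complete by (intro icycle_triangle[OF symF assms(1)]) auto
  then show False using assms(2) T vertex_partition by auto
qed

text \<open>A cycle meeting \<open>R\<close> avoids \<open>w\<close> and has at most two vertices in
  the clique \<open>T\<close>. With none, it is a cycle of the original graph already; with one or
  two, the preceding lifts apply.\<close>

lemma lift_cycle:
  assumes Y: "icycle F Y" "Y \<subseteq> f ` V" "Y \<inter> R \<noteq> {}"
  obtains X where "icycle E X" "X \<subseteq> V" "X \<inter> R = Y \<inter> R" "f ` (X \<inter> N) = Y \<inter> T"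
proof (cases "Y \<inter> T = {}")
  case True
  have YR: "Y \<subseteq> R" using Y(2)[unfolded fV] icycle_F_no_w[OF Y(1,3)] True by blast
  then have "icycle E Y" by (intro icycle_cong[OF Y(1)] F_R) auto
  moreover have "Y \<inter> N = {}" "Y \<subseteq> V" using YR vertex_partition by blast+
  ultimately show thesis using that[of Y] True by simp
next
  case False
  note result = that
  obtain t where t: "t \<in> Y" "t \<in> T" using False by blast
  obtain ps where ps: "Y = insert t (set ps)" "2 \<le> length ps" "ipath F ps" "t \<notin> set ps"
    "\<And>p. p \<in> set ps \<Longrightarrow> F t p \<longleftrightarrow> p = hd ps \<or> p = last ps"
    by (rule icycle_rotate[OF symF Y(1) t(1)]) (rule that)
  have YTR: "Y \<subseteq> T \<union> R" using Y(2)[unfolded fV] icycle_F_no_w[OF Y(1,3)] by blast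
  \<comment> \<open>It suffices to treat a second clique vertex \<open>s\<close> at the head of the
    path; if it is the last vertex, the path is reversed.\<close>
  have two: thesis
    if q: "Y = insert t (set (s # qs))" "qs \<noteq> []" "ipath F (s # qs)" "t \<notin> set (s # qs)" "s \<in> T"
      "\<And>p. p \<in> set (s # qs) \<Longrightarrow> F t p \<longleftrightarrow> p = s \<or> p = last qs" for s qs
  proof -
    have sq: "s \<notin> set qs" using q(3) by simp
    \<comment> \<open>A third vertex of \<open>T\<close> would form a triangle with \<open>t\<close>
      and \<open>s\<close>; this triangle would be all of \<open>Y\<close> and miss
      \<open>R\<close>.\<close>
    have "p \<notin> T" if "p \<in> set qs" for p
    proof
      assume "p \<in> T"
      then have "Y = {t, s, p}"
        using q that t sq complete by (intro icycle_triangle[OF symF Y(1)]) auto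
      then show False using Y(3) t q(5) \<open>p \<in> T\<close> vertex_partition by auto
    qed
    then have qR: "set qs \<subseteq> R" using YTR q(1) by auto
    have F: "F s p \<longleftrightarrow> p = hd qs" "F t p \<longleftrightarrow> p = last qs" if "p \<in> set qs" for p
      using q(3) q(6)[of p] that sq by auto
    have Y': "Y \<inter> R = set qs" "Y \<inter> T = {t, s}" using qR q(1,5) t vertex_partition by auto
    show thesis
    proof (rule lift_cycle_two[of t s qs])
      show "t \<noteq> s" "ipath F qs" using q(3,4) by auto
      show thesis if "icycle E X" "X \<subseteq> V" "X \<inter> R = set qs" "f ` (X \<inter> N) = {t, s}" for X
        using that Y' by (intro result) auto
    qed (use t q(2,5) qR F in auto)
  qed
  show thesis
  proof (cases "set ps \<inter> T = {}")
    case True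
    then have pR: "set ps \<subseteq> R" using YTR ps(1) by blast
    obtain X where X: "icycle E X" "X \<subseteq> V" "X \<inter> R = set ps" "f ` (X \<inter> N) = {t}"
      using lift_cycle_one[of t ps] t pR ps by blast
    moreover have "Y \<inter> R = set ps" "Y \<inter> T = {t}" using pR ps(1) t vertex_partition by auto
    ultimately show thesis using that by simp
  next
    case False
    then obtain s where s: "s \<in> set ps" "s \<in> T" by blast
    have "F t s" using complete s t ps(4) by metis
    then have "s = hd ps \<or> s = last ps" using ps(5) s by blast
    then show thesis
    proof
      assume sh: "s = hd ps"
      obtain qs where qs: "ps = s # qs" "qs \<noteq> []" using sh ps(2) by (cases ps) (auto simp: Suc_le_eq)
      show thesis by (rule two[of s qs]) (use qs ps s in auto)
    next
      assume sl: "s = last ps"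
      have "ps \<noteq> []" using ps by auto
      obtain rs where rs: "ps = rs @ [s]" using sl \<open>ps \<noteq> []\<close> by (metis append_butlast_last_id)
      have "rs \<noteq> []" using rs ps(2) by auto
      have rev: "rev ps = s # rev rs" using rs by simp
      have ip: "ipath F (s # rev rs)" using ps(3) ipath_rev[OF symF, of ps] rev by simp
      have l: "last (rev rs) = hd ps" using rs \<open>rs \<noteq> []\<close> by (simp add: last_rev)
      have set_ps: "set (s # rev rs) = set ps" using rs by simp
      show thesis
      proof (rule two)
        show "F t p \<longleftrightarrow> p = s \<or> p = last (rev rs)" if "p \<in> set (s # rev rs)" for p
        proof -
          have "p \<in> set ps" using that set_ps by blast
          then show ?thesis unfolding l sl using ps(5) by blast
        qed
        show "rev rs \<noteq> []" using \<open>rs \<noteq> []\<close> by simp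
      qed (use ip set_ps ps(1,4) s(2) in auto)
    qed
  qed
qed

section \<open>Counting cycles and edges on both sides\<close>

text \<open>A cycle missing \<open>R\<close> lies in the clique \<open>insert w T\<close> and is
  therefore a triangle, which gives the binomial term.\<close>

lemma card_icycles_R_le:
  "card {Y. icycle F Y \<and> Y \<subseteq> f ` V} \<le>
   card {Y. icycle F Y \<and> Y \<subseteq> f ` V \<and> Y \<inter> R \<noteq> {}} + (Suc (card T) choose 3)"
proof -
  let ?A = "{Y. icycle F Y \<and> Y \<subseteq> f ` V \<and> Y \<inter> R \<noteq> {}}"
  let ?B = "{Y. Y \<subseteq> insert w T \<and> card Y = 3}"
  have clq: "F x y" if "x \<in> insert w T" "y \<in> insert w T" "x \<noteq> y" for x y
    using that complete F_w F_sym by (metis insertE)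
  have "{Y. icycle F Y \<and> Y \<subseteq> f ` V} \<subseteq> ?A \<union> ?B"
  proof
    fix Y assume "Y \<in> {Y. icycle F Y \<and> Y \<subseteq> f ` V}"
    then have Y: "icycle F Y" "Y \<subseteq> f ` V" by auto
    show "Y \<in> ?A \<union> ?B"
    proof (cases "Y \<inter> R = {}")
      case True
      then have sub: "Y \<subseteq> insert w T" using Y(2) unfolding fV by blast
      have "F x y" if "x \<in> Y" "y \<in> Y" "x \<noteq> y" for x y
        by (rule clq) (use that sub in blast)+
      then have "card Y = 3" by (rule icycle_clique_card[OF symF Y(1)])
      then show ?thesis using sub by blast
    qed (use Y in blast)
  qed
  moreover have fA: "finite ?A"
    by (rule finite_subset[of _ "Pow (f ` V)"]) (use fin in auto)
  moreover have "finite ?B" by (rule finite_subset[of _ "Pow (insert w T)"]) (use vertex_partition in auto)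
  ultimately have "card {Y. icycle F Y \<and> Y \<subseteq> f ` V} \<le> card (?A \<union> ?B)" by (intro card_mono) auto
  also have "\<dots> \<le> card ?A + card ?B" by (rule card_Un_le)
  also have "card ?B = (Suc (card T) choose 3)"
    using n_subsets[of "insert w T" 3] vertex_partition by simp
  finally show ?thesis .
qed

lemma card_edges_T: "card {{u, v} |u v. u \<in> T \<and> v \<in> T \<and> F u v} = (card T choose 2)"
proof -
  have "{{u, v} |u v. u \<in> T \<and> v \<in> T \<and> F u v} = {e. e \<subseteq> T \<and> card e = 2}"
  proof (intro equalityI subsetI)
    fix e assume "e \<in> {{u, v} |u v. u \<in> T \<and> v \<in> T \<and> F u v}"
    then obtain u v where "e = {u, v}" "u \<in> T" "v \<in> T" "F u v" by blast
    moreover have "u \<noteq> v" using \<open>F u v\<close> irrF by (auto dest: irreflpD)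
    ultimately show "e \<in> {e. e \<subseteq> T \<and> card e = 2}" by simp
  next
    fix e assume "e \<in> {e. e \<subseteq> T \<and> card e = 2}"
    then obtain u v where "e = {u, v}" "u \<in> T" "v \<in> T" "u \<noteq> v" by (auto simp: card_2_iff)
    then show "e \<in> {{u, v} |u v. u \<in> T \<and> v \<in> T \<and> F u v}" using complete by blast
  qed
  then show ?thesis using n_subsets[of T 2] vertex_partition by simp
qed

definition four_cycles :: "'a set set" where
  "four_cycles = {{w, a, r, b} |a r b. a \<in> N \<and> b \<in> N \<and> r \<in> R \<and> a \<noteq> b \<and> f a = f b \<and> E r a \<and> E r b}"

text \<open>Equal images make \<open>a\<close> and \<open>b\<close> nonadjacent, so the path from
  \<open>b\<close> over \<open>r\<close> to \<open>a\<close> is closed by \<open>w\<close> without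
  chords.\<close>

lemma four_cycles_icycle: "X \<in> four_cycles \<Longrightarrow> icycle E X"
proof -
  assume "X \<in> four_cycles"
  then obtain a r b where X: "X = {w, a, r, b}"
    and x: "a \<in> N" "b \<in> N" "r \<in> R" "a \<noteq> b" "f a = f b" "E r a" "E r b"
    by (auto simp: four_cycles_def)
  have "icycle E (insert w (insert a (insert b (set [r]))))"
    using x proper[of a b] E_sym[of r] by (intro icycle_through_w) auto
  moreover have "insert w (insert a (insert b (set [r]))) = X" using X by auto
  ultimately show "icycle E X" by simp
qed

text \<open>
  Each edge between \<open>R\<close> and \<open>T\<close> of the compressed graph keeps one preimage \<open>(r, b)\<close>; every other
  preimage \<open>(r, a)\<close> is recorded by the four-cycle \<open>w, a, r, b\<close>.
\<close>

lemma card_cross_le: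
  "card {(r, a). r \<in> R \<and> a \<in> N \<and> E r a} \<le>
   card {(r, t). r \<in> R \<and> t \<in> T \<and> F r t} + card four_cycles"
proof -
  let ?X = "{(r, a). r \<in> R \<and> a \<in> N \<and> E r a}"
  define g where "g = (\<lambda>(r :: 'a, a). (r, f a))"
  define rep where "rep = inv_into ?X g"
  let ?h = "\<lambda>(r, a). {w, a, r, snd (rep (g (r, a)))}"
  have finX: "finite ?X" by (rule finite_subset[of _ "R \<times> N"]) (use vertex_partition in auto)
  have img: "g ` ?X = {(r, t). r \<in> R \<and> t \<in> T \<and> F r t}"
  proof -
    have F: "F r t \<longleftrightarrow> (\<exists>a\<in>N. f a = t \<and> E r a)" if "r \<in> R" "t \<in> T" for r t
      unfolding F_sym[of r t] E_sym[of r] by (rule F_T_R[OF that(2,1)])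
    show ?thesis
    proof (intro equalityI subsetI)
      fix y assume "y \<in> g ` ?X"
      then obtain r a where "y = (r, f a)" "r \<in> R" "a \<in> N" "E r a" by (auto simp: g_def)
      moreover from this have "f a \<in> T" by (simp add: T_def)
      ultimately show "y \<in> {(r, t). r \<in> R \<and> t \<in> T \<and> F r t}" using F[of r "f a"] by auto
    next
      fix y assume "y \<in> {(r, t). r \<in> R \<and> t \<in> T \<and> F r t}"
      then obtain r t where y: "y = (r, t)" "r \<in> R" "t \<in> T" "F r t" by auto
      then obtain a where "a \<in> N" "f a = t" "E r a" using F[of r t] by auto
      then show "y \<in> g ` ?X" using y by (intro image_eqI[of _ _ "(r, a)"]) (auto simp: g_def)
    qed
  qed
  have rep: "rep y \<in> ?X" "g (rep y) = y" if "y \<in> g ` ?X" for y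
    unfolding rep_def by (rule inv_into_into[OF that]) (rule f_inv_into_f[OF that])
  have rep': "\<exists>b. rep (g (r, a)) = (r, b) \<and> b \<in> N \<and> E r b \<and> f b = f a" if "(r, a) \<in> ?X" for r a
  proof -
    have "g (r, a) \<in> g ` ?X" using that by blast
    note q = rep[OF this]
    obtain r' b where rb: "rep (g (r, a)) = (r', b)" by fastforce
    show ?thesis using q unfolding rb by (auto simp: g_def)
  qed
  have sub: "rep ` g ` ?X \<subseteq> ?X" by (intro image_subsetI rep(1))
  have card_rep: "card (rep ` g ` ?X) = card (g ` ?X)"
    by (intro card_image inj_on_inverseI[of _ g] rep(2))
  let ?D = "?X - rep ` g ` ?X"
  have D: "\<exists>b. rep (g (r, a)) = (r, b) \<and> b \<in> N \<and> E r b \<and> f b = f a \<and> b \<noteq> a \<and> r \<in> R \<and> a \<in> N \<and> E r a"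
    if "(r, a) \<in> ?D" for r a
  proof -
    have ra: "(r, a) \<in> ?X" using that by blast
    obtain b where b: "rep (g (r, a)) = (r, b)" "b \<in> N" "E r b" "f b = f a" using rep'[OF ra] by blast
    have "b \<noteq> a"
    proof
      assume "b = a"
      then have "(r, a) = rep (g (r, a))" using b by simp
      then show False using that ra by blast
    qed
    then show ?thesis using b ra by blast
  qed
  have "?h ` ?D \<subseteq> four_cycles"
  proof
    fix X assume "X \<in> ?h ` ?D"
    then obtain r a where "(r, a) \<in> ?D" "X = {w, a, r, snd (rep (g (r, a)))}" by auto
    then show "X \<in> four_cycles" using D[of r a] unfolding four_cycles_def by fastforce
  qed
  \<comment> \<open>The four-cycle returns \<open>r\<close> as its vertex in \<open>R\<close> and
    the pair of \<open>a\<close> with its representative as its vertices in \<open>N\<close>. The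
    common image under \<open>f\<close> determines the representative, and \<open>a\<close> is the
    other one.\<close>
  moreover have "inj_on ?h ?D"
  proof (rule inj_onI)
    fix x y assume x: "x \<in> ?D" and y: "y \<in> ?D" and eq: "?h x = ?h y"
    obtain r a where ra: "x = (r, a)" by fastforce
    obtain s c where sc: "y = (s, c)" by fastforce
    obtain b where b: "rep (g (r, a)) = (r, b)" "b \<in> N" "f b = f a" "b \<noteq> a" "r \<in> R" "a \<in> N"
      using D x ra by blast
    obtain d where d: "rep (g (s, c)) = (s, d)" "d \<in> N" "f d = f c" "d \<noteq> c" "s \<in> R" "c \<in> N"
      using D y sc by blast
    have e: "{w, a, r, b} = {w, c, s, d}" using eq ra sc b d by simp
    have "{w, a, r, b} \<inter> R = {r}" "{w, c, s, d} \<inter> R = {s}" using b d vertex_partition by blast+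
    then have rs: "r = s" using e by simp
    have "{w, a, r, b} \<inter> N = {a, b}" "{w, c, s, d} \<inter> N = {c, d}" using b d vertex_partition by blast+
    then have ab: "{a, b} = {c, d}" using e by simp
    then have "f a = f c" using b(3) d(3) by (auto simp: doubleton_eq_iff)
    then have "g (r, a) = g (s, c)" using rs by (simp add: g_def)
    then have "b = d" using b(1) d(1) by simp
    then show "x = y" using ab b(4) ra sc rs by (auto simp: doubleton_eq_iff)
  qed
  moreover have "finite four_cycles"
  proof (rule finite_subset[of _ "Pow V"])
    show "four_cycles \<subseteq> Pow V" using vertex_partition unfolding four_cycles_def by auto
  qed (use fin in simp)
  ultimately have "card ?D \<le> card four_cycles" by (intro card_inj_on_le[of ?h])
  moreover have "card ?D = card ?X - card (g ` ?X)"
    using card_Diff_subset[OF finite_subset[OF sub finX] sub] card_rep by simp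
  ultimately show ?thesis unfolding img by linarith
qed

text \<open>Four disjoint families are exhibited: triangles through \<open>w\<close>, cycles inside
  \<open>N\<close>, the four-cycles and the lifted cycles. The first two miss \<open>R\<close> and
  are told apart by \<open>w\<close>; the last two meet \<open>R\<close> and are told apart by the
  size of their projection.\<close>

lemma card_icycles_E_ge:
  "card {{u, v} |u v. u \<in> N \<and> v \<in> N \<and> E u v} + (card T choose 3) + card four_cycles +
   card {Y. icycle F Y \<and> Y \<subseteq> f ` V \<and> Y \<inter> R \<noteq> {}} \<le> card {X. icycle E X \<and> X \<subseteq> V}"
proof -
  let ?CR = "{Y. icycle F Y \<and> Y \<subseteq> f ` V \<and> Y \<inter> R \<noteq> {}}"
  let ?EN = "{{u, v} |u v. u \<in> N \<and> v \<in> N \<and> E u v}"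
  let ?all = "{X. icycle E X \<and> X \<subseteq> V}"
  define K1 where "K1 = insert w ` ?EN"
  define K2 where "K2 = {X. icycle E X \<and> X \<subseteq> N}"
  have "\<forall>Y\<in>?CR. \<exists>X. icycle E X \<and> X \<subseteq> V \<and> X \<inter> R = Y \<inter> R \<and> f ` (X \<inter> N) = Y \<inter> T"
  proof
    fix Y assume "Y \<in> ?CR"
    then have Y: "icycle F Y" "Y \<subseteq> f ` V" "Y \<inter> R \<noteq> {}" by auto
    show "\<exists>X. icycle E X \<and> X \<subseteq> V \<and> X \<inter> R = Y \<inter> R \<and> f ` (X \<inter> N) = Y \<inter> T"
      by (rule lift_cycle[OF Y]) blast
  qed
  from bchoice[OF this] obtain G where G_all:
    "\<forall>Y\<in>?CR. icycle E (G Y) \<and> G Y \<subseteq> V \<and> G Y \<inter> R = Y \<inter> R \<and> f ` (G Y \<inter> N) = Y \<inter> T"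
    by (elim exE)
  note G = bspec[OF G_all]
  define K4 where "K4 = G ` ?CR"
  \<comment> \<open>Since \<open>w\<close> is not on \<open>Y\<close>, the traces on
    \<open>R\<close> and \<open>T\<close> preserved by the lift determine \<open>Y\<close>; this
    makes \<open>G\<close> injective.\<close>
  have Ysplit: "Y = (Y \<inter> R) \<union> (Y \<inter> T)" if "Y \<in> ?CR" for Y
  proof -
    have "w \<notin> Y" using that icycle_F_no_w by blast
    moreover have "Y \<subseteq> insert w (T \<union> R)" using that fV by auto
    ultimately show ?thesis by blast
  qed
  have "inj_on G ?CR"
  proof (rule inj_onI)
    fix Y Z assume "Y \<in> ?CR" "Z \<in> ?CR" "G Y = G Z"
    then have "Y \<inter> R = Z \<inter> R" "Y \<inter> T = Z \<inter> T" using G[of Y] G[of Z] by auto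
    then show "Y = Z" using Ysplit \<open>Y \<in> ?CR\<close> \<open>Z \<in> ?CR\<close> by blast
  qed
  then have card4: "card K4 = card ?CR" unfolding K4_def by (rule card_image)
  have "inj_on (insert w) ?EN"
    by (rule inj_onI) (use vertex_partition(1) in \<open>auto simp: insert_ident\<close>)
  then have card1: "card K1 = card ?EN" unfolding K1_def by (rule card_image)
  have card2: "card T choose 3 \<le> card K2"
    unfolding K2_def by (rule card_icycles_ge[OF symE irrE]) (use vertex_partition chromatic in auto)
  have K1: "w \<in> X \<and> X \<inter> R = {} \<and> X \<in> ?all" if "X \<in> K1" for X
  proof -
    obtain u v where uv: "u \<in> N" "v \<in> N" "E u v" "X = {w, u, v}"
      using \<open>X \<in> K1\<close> unfolding K1_def by auto
    have "u \<noteq> v" using uv E_irr by blast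
    then have "icycle E X"
      unfolding icycle_def using uv vertex_partition(1)
      by (intro exI[of _ w] exI[of _ "[u, v]"]) (auto simp: N_def)
    then show ?thesis using uv vertex_partition by auto
  qed
  have K2: "w \<notin> X \<and> X \<inter> R = {} \<and> X \<in> ?all" if "X \<in> K2" for X
    using that vertex_partition unfolding K2_def by auto
  have K3: "X \<inter> R \<noteq> {} \<and> card ((X \<inter> R) \<union> f ` (X \<inter> N)) \<le> 2 \<and> X \<in> ?all" if X: "X \<in> four_cycles" for X
  proof -
    obtain a r b where "X = {w, a, r, b}"
      and x: "a \<in> N" "b \<in> N" "r \<in> R" "a \<noteq> b" "f a = f b" "E r a" "E r b"
      using X by (auto simp: four_cycles_def)
    then have "X \<inter> R = {r}" "X \<inter> N = {a, b}" "X \<subseteq> V" using vertex_partition by auto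
    moreover have "card ({r} \<union> f ` {a, b}) \<le> 2"
      using x(5) by (simp add: card_insert_le_m1)
    ultimately show ?thesis using four_cycles_icycle[OF X] by simp
  qed
  have K4: "X \<inter> R \<noteq> {} \<and> 3 \<le> card ((X \<inter> R) \<union> f ` (X \<inter> N)) \<and> X \<in> ?all" if "X \<in> K4" for X
  proof -
    obtain Y where Y: "Y \<in> ?CR" "X = G Y" using \<open>X \<in> K4\<close> unfolding K4_def by blast
    have "(X \<inter> R) \<union> f ` (X \<inter> N) = Y" using G[OF Y(1)] Ysplit[OF Y(1)] Y(2) by simp
    moreover have "3 \<le> card Y" using Y(1) icycle_card_ge by blast
    moreover have "X \<inter> R \<noteq> {}" "X \<in> ?all" using G[OF Y(1)] Y by auto
    ultimately show ?thesis by simp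
  qed
  have fall: "finite ?all" by (rule finite_subset[of _ "Pow V"]) (use fin in auto)
  have sub: "K1 \<subseteq> ?all" "K2 \<subseteq> ?all" "four_cycles \<subseteq> ?all" "K4 \<subseteq> ?all"
    using K1 K2 K3 K4 by blast+
  note fins = sub[THEN finite_subset[OF _ fall]]
  have d1: "K1 \<inter> K2 = {}" using K1 K2 by blast
  have d2: "(K1 \<union> K2) \<inter> four_cycles = {}" using K1 K2 K3 by blast
  have d3: "(K1 \<union> K2 \<union> four_cycles) \<inter> K4 = {}"
  proof -
    have "X \<notin> K4" if "X \<in> four_cycles" for X using K3[OF that] K4[of X] by linarith
    then show ?thesis using K1 K2 K4 by blast
  qed
  have "card K1 + card K2 + card four_cycles + card K4 = card (K1 \<union> K2 \<union> four_cycles \<union> K4)"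
    using fins d1 d2 d3 by (simp add: card_Un_disjoint)
  also have "\<dots> \<le> card ?all" using sub fall by (intro card_mono) auto
  finally show ?thesis using card1 card2 card4 by linarith
qed

text \<open>Sums replace differences to stay within natural numbers. Edges inside \<open>N\<close>
  are balanced by triangles through \<open>w\<close>, edges at \<open>w\<close> by the vertices of
  \<open>N\<close> and \<open>T\<close>, lost cross edges by four-cycles, and the clique triangles,
  by Pascal's rule, by the edges inside \<open>T\<close> and the cycles inside
  \<open>N\<close>.\<close>

lemma beth2_compression_le:
  "card {Y. icycle F Y \<and> Y \<subseteq> f ` V} + card {{u, v} |u v. E u v} + card (f ` V) \<le>
   card {X. icycle E X \<and> X \<subseteq> V} + card {{u, v} |u v. F u v} + card V"
proof -
  have NF: "{v. F w v} = T" using F_w by auto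
  have RF: "f ` V - insert w T = R" using fV vertex_partition by blast
  have edgesF: "card {{u, v} |u v. F u v} =
      card {{u, v} |u v. u \<in> R \<and> v \<in> R \<and> F u v} + card {{u, v} |u v. u \<in> T \<and> v \<in> T \<and> F u v} +
      card T + card {(r, a). r \<in> R \<and> a \<in> T \<and> F r a}"
    using card_edges_at_vertex[OF symF irrF, of "f ` V" w] fin F_V unfolding NF RF by simp
  have edgesE: "card {{u, v} |u v. E u v} =
      card {{u, v} |u v. u \<in> R \<and> v \<in> R \<and> E u v} + card {{u, v} |u v. u \<in> N \<and> v \<in> N \<and> E u v} +
      card N + card {(r, a). r \<in> R \<and> a \<in> N \<and> E r a}"
    using card_edges_at_vertex[OF symE irrE fin, of w] EV unfolding N_def R_def by simp
  have ER: "{{u, v} |u v. u \<in> R \<and> v \<in> R \<and> F u v} = {{u, v} |u v. u \<in> R \<and> v \<in> R \<and> E u v}"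
    using F_R by blast
  have "card V = Suc (card N + card R)"
    unfolding vertex_partition(7) using vertex_partition(1,2,3,8,9) by (simp add: card_Un_disjoint)
  moreover have "card (f ` V) = Suc (card T + card R)"
    unfolding fV using vertex_partition(2,5,6,9,10) by (simp add: card_Un_disjoint)
  moreover have "Suc (card T) choose 3 = (card T choose 2) + (card T choose 3)"
    by (simp add: numeral_3_eq_3 numeral_2_eq_2)
  ultimately show ?thesis
    using card_icycles_R_le card_icycles_E_ge card_cross_le card_edges_T edgesE edgesF[unfolded ER]
    by linarith
qed

end

section \<open>Graphs as sets of ordered pairs\<close>

lemma arcs_ends_induce: "arcs_ends (with_proj G \<restriction> X) = {(u, v) \<in> parcs G. u \<in> X \<and> v \<in> X}"
  by (force simp: arcs_ends_conv)

lemma graph_induce: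
  assumes "pair_graph G" "X \<subseteq> pverts G"
  shows "graph (with_proj G \<restriction> X)"
proof -
  interpret pair_graph G by fact
  have ind: "induced_subgraph (with_proj G \<restriction> X) (with_proj G)"
    using assms(2) by (intro induced_induce) simp
  interpret I: digraph "with_proj G \<restriction> X" by (rule digraphI_induced[OF ind])
  show ?thesis
    by unfold_locales (rule induced_graph_imp_symmetric[OF sym_arcs ind])
qed

text \<open>An induced subgraph is determined by its vertices, so \<open>verts\<close> is a
  bijection from induced cycles to their vertex sets.\<close>

lemma card_induced_cycles:
  fixes G :: "'a pair_pre_digraph"
  assumes "pair_graph G"
  shows "card (induced_cycles (with_proj G)) =
    card {X. icycle (\<lambda>a b. (a, b) \<in> parcs G) X \<and> X \<subseteq> pverts G}"
proof -
  interpret pair_graph G by fact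
  let ?E = "\<lambda>a b. (a, b) \<in> parcs G"
  have s: "symp ?E" using sym_arcs by (auto simp: symmetric_def intro: sympI dest: symD)
  have i: "irreflp ?E" using pair_no_loops by (force intro: irreflpI)
  have cyc: "cycle_graph (with_proj G \<restriction> X) \<longleftrightarrow> icycle ?E X" if "X \<subseteq> pverts G" for X
  proof -
    have "uedges (with_proj G \<restriction> X) = {{u, v} |u v. u \<in> X \<and> v \<in> X \<and> (u, v) \<in> parcs G}"
      unfolding uedges_def arcs_ends_induce by blast
    then show ?thesis
      unfolding cycle_graph_def icycle_iff_cyclic_list[OF s i]
      using graph_induce[OF assms that] by simp
  qed
  have restr: "with_proj G \<restriction> verts C = C" if "C \<in> induced_cycles (with_proj G)" for C
    using that by (intro induce_eq_iff_induced) (simp add: induced_cycles_def)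
  have "verts ` induced_cycles (with_proj G) = {X. icycle ?E X \<and> X \<subseteq> pverts G}"
  proof (intro equalityI subsetI)
    fix X assume "X \<in> verts ` induced_cycles (with_proj G)"
    then obtain C where C: "C \<in> induced_cycles (with_proj G)" "X = verts C" by blast
    then have "subgraph C (with_proj G)"
      by (simp add: induced_cycles_def induced_imp_subgraph)
    then have "X \<subseteq> pverts G" using C(2) by (auto simp: subgraph_def)
    moreover have "cycle_graph (with_proj G \<restriction> X)"
      using C restr[OF C(1)] by (simp add: induced_cycles_def)
    ultimately show "X \<in> {X. icycle ?E X \<and> X \<subseteq> pverts G}" using cyc by blast
  next
    fix X assume "X \<in> {X. icycle ?E X \<and> X \<subseteq> pverts G}"
    then have X: "X \<subseteq> pverts G" "icycle ?E X" by auto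
    have "induced_subgraph (with_proj G \<restriction> X) (with_proj G)"
      using X(1) by (intro induced_induce) simp
    then have "with_proj G \<restriction> X \<in> induced_cycles (with_proj G)"
      using cyc[OF X(1)] X(2) by (simp add: induced_cycles_def)
    then show "X \<in> verts ` induced_cycles (with_proj G)" by (rule rev_image_eqI) simp
  qed
  moreover have "inj_on verts (induced_cycles (with_proj G))"
    by (rule inj_on_inverseI[of _ "\<lambda>X. with_proj G \<restriction> X"]) (rule restr)
  ultimately show ?thesis by (metis card_image)
qed

lemma beth2_pair_graph:
  fixes G :: "'a pair_pre_digraph"
  assumes "pair_graph G"
  shows "beth2 (with_proj G) =
    int (card {X. icycle (\<lambda>a b. (a, b) \<in> parcs G) X \<and> X \<subseteq> pverts G}) -
    int (card {{u, v} |u v. (u, v) \<in> parcs G}) + int (card (pverts G))"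
  unfolding beth2_def card_induced_cycles[OF assms] by (simp add: uedges_def)

text \<open>Successive contractions compose to one identification map. It stays proper because only
  nonadjacent vertices are merged, and it fixes \<open>w\<close>, which is adjacent to all other
  vertices of the current image of \<open>S\<close>.\<close>

lemma nonedge_contractions_quotient:
  assumes "nonedge_contractions G S H T"
    and G: "pair_graph G" and S: "S = insert w {v. (w, v) \<in> parcs G}" and w: "w \<in> pverts G"
  shows "\<exists>f. pverts H = f ` pverts G \<and> parcs H = map_prod f f ` parcs G \<and>
    (\<forall>x\<in>pverts G - S. f x = x) \<and> f w = w \<and> T = f ` S \<and> T \<subseteq> S \<and>
    (\<forall>a b. (a, b) \<in> parcs G \<longrightarrow> f a \<noteq> f b)"
  using assms(1)
proof (induction rule: nonedge_contractions.induct)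
  case base
  interpret pair_graph G by fact
  show ?case using pair_no_loops by (intro exI[of _ id]) (force simp: prod.map_id)
next
  case (step H T u v)
  interpret pair_graph G by fact
  have symG: "(b, a) \<in> parcs G" if "(a, b) \<in> parcs G" for a b
    using sym_arcs that by (auto simp: symmetric_def dest: symD)
  obtain f where f: "pverts H = f ` pverts G" "parcs H = map_prod f f ` parcs G"
    "\<forall>x\<in>pverts G - S. f x = x" "f w = w" "T = f ` S" "T \<subseteq> S"
    "\<forall>a b. (a, b) \<in> parcs G \<longrightarrow> f a \<noteq> f b"
    using step.IH by blast
  have H: "(x, y) \<in> parcs H \<longleftrightarrow> (\<exists>a b. (a, b) \<in> parcs G \<and> x = f a \<and> y = f b)" for x y
    unfolding f(2) by force
  have uv: "u \<in> T" "v \<in> T" "u \<noteq> v" "(u, v) \<notin> parcs H" "(v, u) \<notin> parcs H"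
    using step.hyps H symG by blast+
  have "S \<subseteq> pverts G" using w S in_arcsD2 by blast
  \<comment> \<open>Were \<open>w\<close> the vertex to be absorbed, its partner \<open>u\<close>
    would be the image of a neighbour of \<open>w\<close>, hence adjacent to it.\<close>
  have vw: "v \<noteq> w"
  proof
    assume "v = w"
    then obtain x where "u = f x" "x \<in> S" "x \<noteq> w" using uv(1,3) f(4,5) by blast
    then have "(w, u) \<in> parcs H" using S H f(4) by (metis insertE mem_Collect_eq)
    then show False using uv(5) \<open>v = w\<close> by simp
  qed
  let ?g = "id(v := u) \<circ> f"
  have "pverts (nonedge_contract H u v) = ?g ` pverts G"
  proof -
    have "u \<in> f ` pverts G" using uv(1) f(5) \<open>S \<subseteq> pverts G\<close> by blast
    then show ?thesis using f(1) uv(3) by (auto simp: nonedge_contract_def image_iff)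
  qed
  moreover have "parcs (nonedge_contract H u v) = map_prod ?g ?g ` parcs G"
    by (simp add: nonedge_contract_def f(2) image_image prod.map_comp)
  moreover have "\<forall>x\<in>pverts G - S. ?g x = x" using f(3,6) uv(2) by auto
  moreover have "?g w = w" using f(4) vw by simp
  moreover have "T - {v} = ?g ` S" using uv f(5) by (auto simp: image_iff)
  moreover have "T - {v} \<subseteq> S" using f(6) by blast
  moreover have "?g a \<noteq> ?g b" if "(a, b) \<in> parcs G" for a b
  proof -
    have "f a \<noteq> f b" "(f a, f b) \<in> parcs H" using f(7) H that by blast+
    then show ?thesis using uv(4,5) by auto
  qed
  ultimately show ?case by blast
qed

theorem theorem3p2p1:
  fixes G H :: "'a pair_pre_digraph" and w :: 'a
  assumes "pair_graph G"
    and "connected (with_proj G)"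
    and "w \<in> pverts G"
    and "vertex_compression G w H"
  shows "beth2 (with_proj H) \<le> beth2 (with_proj G)"
proof -
  interpret pair_graph G by fact
  let ?V = "pverts G" and ?E = "\<lambda>a b. (a, b) \<in> parcs G"
  define N where "N = {v. ?E w v}"
  define S where "S = insert w N"
  have symE: "symp ?E" using sym_arcs by (auto simp: symmetric_def intro: sympI dest: symD)
  have irrE: "irreflp ?E" using pair_no_loops by (force intro: irreflpI)
  have EV: "?E a b \<Longrightarrow> a \<in> ?V" "?E a b \<Longrightarrow> b \<in> ?V" for a b using in_arcsD1 in_arcsD2 by auto
  have S_eq: "closed_nbhd (with_proj G) w = S" by (simp add: closed_nbhd_def S_def N_def)
  obtain T where T: "nonedge_contractions G S H T"
    "complete_digraph (chromatic_number (with_proj G \<restriction> S)) (with_proj H \<restriction> T)"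
    using assms(4) unfolding vertex_compression_def S_eq by blast
  obtain f where f: "pverts H = f ` ?V" "parcs H = map_prod f f ` parcs G"
    "\<forall>x\<in>?V - S. f x = x" "f w = w" "T = f ` S" "T \<subseteq> S" "\<forall>a b. ?E a b \<longrightarrow> f a \<noteq> f b"
    using nonedge_contractions_quotient[OF T(1) assms(1) _ assms(3)] S_def N_def by blast
  let ?F = "\<lambda>s t. \<exists>a b. ?E a b \<and> f a = s \<and> f b = t"
  have H: "(s, t) \<in> parcs H \<longleftrightarrow> ?F s t" for s t unfolding f(2) by force
  have SV: "S \<subseteq> ?V" using assms(3) EV by (auto simp: S_def N_def)
  have wN: "w \<notin> f ` N" using f(4,7) by (metis N_def imageE mem_Collect_eq)
  have TN: "T = insert w (f ` N)" using f(4,5) by (simp add: S_def)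
  have fin_N: "finite N" using SV pair_finite_verts by (auto simp: S_def intro: finite_subset)
  have "compression ?E ?V w f"
  proof
    show "finite ?V" by (rule pair_finite_verts)
    show "w \<in> ?V" by fact
    show "symp ?E" "irreflp ?E" by fact+
    show "a \<in> ?V" if "?E a b" for a b using EV that by blast
    show "f w = w" by fact
    show "f x = x" if "x \<in> ?V - insert w {v. ?E w v}" for x
      using f(3) that by (simp add: S_def N_def)
    show "f x \<in> {v. ?E w v}" if "x \<in> {v. ?E w v}" for x
      using that f(6) wN unfolding TN S_def N_def by blast
    show "f a \<noteq> f b" if "?E a b" for a b using f(7) that by blast
    show "?F s t" if "s \<in> f ` {v. ?E w v}" "t \<in> f ` {v. ?E w v}" "s \<noteq> t" for s t
    proof -
      have "(s, t) \<in> arcs_ends (with_proj H \<restriction> T)"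
        using T(2) that unfolding complete_digraph_def TN N_def by simp
      then show ?thesis unfolding arcs_ends_induce using H by blast
    qed
    \<comment> \<open>A colouring of \<open>N\<close> with \<open>m\<close> colours extends to
      \<open>w\<close> with one more. The clique has as many vertices as the closed neighbourhood
      needs colours, so \<open>Suc m\<close> is at least its size.\<close>
    show "\<not> colourable ?E {v. ?E w v} m" if "m < card (f ` {v. ?E w v})" for m
    proof
      assume "colourable ?E {v. ?E w v} m"
      then have "colourable ?E S (Suc m)"
        unfolding S_def N_def by (rule colourable_insert[OF irrE])
      then have "\<exists>c. proper_colouring (with_proj G \<restriction> S) (Suc m) c"
        unfolding colourable_def proper_colouring_def arcs_ends_induce by auto
      then have "chromatic_number (with_proj G \<restriction> S) \<le> Suc m"
        unfolding chromatic_number_def by (rule Least_le)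
      moreover have "chromatic_number (with_proj G \<restriction> S) = card T"
        using T(2) by (simp add: complete_digraph_def)
      moreover have "card T = Suc (card (f ` N))" using TN wN fin_N by simp
      ultimately show False using that by (simp add: N_def)
    qed
  qed
  then have le: "card {Y. icycle ?F Y \<and> Y \<subseteq> f ` ?V} + card {{u, v} |u v. ?E u v} + card (f ` ?V) \<le>
      card {X. icycle ?E X \<and> X \<subseteq> ?V} + card {{u, v} |u v. ?F u v} + card ?V"
    by (rule compression.beth2_compression_le)
  have pgH: "pair_graph H"
  proof
    show "finite (pverts H)" "finite (parcs H)"
      unfolding f(1,2) using pair_finite_verts pair_finite_arcs by auto
    show "fst e \<in> pverts H" "snd e \<in> pverts H" if "e \<in> parcs H" for e
      using that EV unfolding f(1,2) by auto
    show "fst e \<noteq> snd e" if "e \<in> parcs H" for e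
      using that f(7) unfolding f(2) by auto
    show "symmetric (with_proj H)"
      unfolding symmetric_def with_proj_simps
      by (rule symI) (use H symE in \<open>metis sympD\<close>)
  qed
  show ?thesis
    unfolding beth2_pair_graph[OF assms(1)] beth2_pair_graph[OF pgH] H f(1)
    using le by linarith
qed

end
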